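(* Let $X$, $Y$, and $Z$ be Banach spaces. Let $1\leq p\leq\infty$. Assume that $S\in\mathcal{L}(Z,\mathcal{L}(X,Y))$. The following statements are equivalent. (a) There exists an operator $U\in\mathcal{L}(Z\hat{\otimes}_{d_{p}}X,Y)$ such that $U^{\#}=S$. (b) There exists a constant $c>0$ such that, for all finite systems $(x_{i})_{i=1}^{n}\subset X$ and $(z_{i})_{i=1}^{n}\subset Z$, \[\|((Sz_{i})x_{i})\|_{p'}^{w}\leq c\,\|(x_{i})\|_{\infty}\|(z_{i})\|_{p'}^{w}.\] (b$'$) There exists a constant $c>0$ such that, for all $(x_{i})\in\ell_{\infty}(X)$ and $(z_{i})\in\ell_{p'}^{w}(Z)$, and for all $n\in\mathbb{N}$, \[\|((Sz_{i})x_{i})_{i=n}^{\infty}\|_{p'}^{w}\leq c\,\|(x_{i})_{i=n}^{\infty}\|_{\infty}\|(z_{i})_{i=n}^{\infty}\|_{p'}^{w}.\] (c) If $(x_{i})\in\ell_{\infty}(X)$ and $(z_{i})\in\ell_{p'}^{w}(Z)$, then $((Sz_{i})x_{i})\in\ell_{p'}^{w}(Y)$. (d) If $(x_{i})\in c_{0}(X)$ and $(z_{i})\in\ell_{p'}^{w}(Z)$, then $((Sz_{i})x_{i})\in\ell_{p'}^{u}(Y)$. (d, alternative version) If $(x_{i})\in\ell_{\infty}(X)$ and $(z_{i})\in\ell_{p'}^{u}(Z)$, then $((Sz_{i})x_{i})\in\ell_{p'}^{u}(Y)$.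
   Context: All Banach spaces are over the same field $\mathbb{K}$ ($\mathbb{R}$ or $\mathbb{C}$); $\mathcal{L}(X,Y)$ is the Banach space of bounded linear operators; $p'$ is the conjugate index, $1/p+1/p'=1$ with $1/\infty=0$. For $1\le q\le\infty$, $\ell_q^w(X)$ is the Banach space of weakly $q$-summable sequences in $X$ with norm $\|(x_i)\|_q^w=\sup_{x^*\in B_{X^*}}(\sum_i|x^*(x_i)|^q)^{1/q}$ (supremum if $q=\infty$; the same formula for finite systems), and $\ell_q^u(X)$ is its closed subspace of unconditionally $q$-summable sequences, i.e. those $(x_n)\in\ell_q^w(X)$ with $(x_n)=\lim_{N\to\infty}(x_1,\dots,x_N,0,0,\dots)$ in $\ell_q^w(X)$. $\|(x_i)\|_\infty=\sup_i\|x_i\|$ and $\|(x_i)\|_p=(\sum\|x_i\|^p)^{1/p}$. $d_p$ is the right Chevet--Saphar tensor norm: for $u\in Z\otimes X$, $d_p(u)=\inf\{\|(z_i)\|_{p'}^w\,\|(x_i)\|_p: u=\sum_{i=1}^n z_i\otimes x_i\}$; $Z\hat{\otimes}_{d_p}X$ is the completion of $Z\otimes X$ in this norm. For $U\in\mathcal{L}(Z\hat{\otimes}_{d_p}X,Y)$, the associated operator $U^{\#}\in\mathcal{L}(Z,\mathcal{L}(X,Y))$ is $(U^{\#}z)x=U(z\otimes x)$. *)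

theory Defs
  imports "HOL-Analysis.Analysis" "HOL-Library.Function_Algebras"
begin

section \<open>Scalars, Banach spaces and operators\<close>

text \<open>
  The scalar field \<open>\<bbbK>\<close> is \<open>\<real>\<close> (first disjunct) or \<open>\<complex>\<close> (second disjunct), with its usual
  absolute value; in the first case the norm is determined by \<open>norm 1 = 1\<close>.
\<close>

class real_or_complex = real_normed_field +
  assumes real_or_complex:
    "(\<forall>a. \<exists>r. a = scaleR r 1) \<or>
     (\<exists>i. i * i = - 1 \<and> (\<forall>a. \<exists>r s. a = scaleR r 1 + scaleR s i) \<and>
          (\<forall>r s. norm (scaleR r 1 + scaleR s i) = sqrt (r\<^sup>2 + s\<^sup>2)))"

instance real :: real_or_complex
  by standard simp

instance complex :: real_or_complex
proof
  have "\<exists>r s. a = scaleR r 1 + scaleR s \<i>" for a :: complex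
    by (rule exI[of _ "Re a"], rule exI[of _ "Im a"]) (simp add: complex_eq_iff)
  moreover have "norm (scaleR r 1 + scaleR s \<i>) = sqrt (r\<^sup>2 + s\<^sup>2)" for r s
    by (simp add: cmod_def)
  ultimately show "(\<forall>a::complex. \<exists>r. a = scaleR r 1) \<or>
     (\<exists>i::complex. i * i = - 1 \<and> (\<forall>a. \<exists>r s. a = scaleR r 1 + scaleR s i) \<and>
          (\<forall>r s. norm (scaleR r 1 + scaleR s i) = sqrt (r\<^sup>2 + s\<^sup>2)))"
    by (intro disjI2 exI[of _ \<i>]) simp
qed

text \<open>
  The class \<open>banach\<close> only provides real scalars. A Banach space over \<open>\<bbbK>\<close> is a type of that class
  together with a multiplication by \<open>\<bbbK>\<close> that extends the real one and for which the norm
  is homogeneous.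
\<close>

definition banach_space :: "('k::real_or_complex \<Rightarrow> 'x::banach \<Rightarrow> 'x) \<Rightarrow> bool" where
  "banach_space sX \<longleftrightarrow>
     vector_space sX \<and>
     (\<forall>r x. sX (of_real r) x = scaleR r x) \<and>
     (\<forall>a x. norm (sX a x) = norm a * norm x)"

definition operators ::
  "('k::real_or_complex \<Rightarrow> 'x::real_normed_vector \<Rightarrow> 'x) \<Rightarrow> ('k \<Rightarrow> 'y::real_normed_vector \<Rightarrow> 'y) \<Rightarrow> ('x \<Rightarrow>\<^sub>L 'y) set"
  where "operators sX sY = {T. Vector_Spaces.linear sX sY (blinfun_apply T)}"

text \<open>\<open>\<L>(Z, \<L>(X, Y))\<close>; multiplication by \<open>\<bbbK>\<close> in \<open>\<L>(X, Y)\<close> is pointwise.\<close>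

definition operators2 ::
  "('k::real_or_complex \<Rightarrow> 'z::real_normed_vector \<Rightarrow> 'z) \<Rightarrow> ('k \<Rightarrow> 'x::real_normed_vector \<Rightarrow> 'x) \<Rightarrow>
   ('k \<Rightarrow> 'y::real_normed_vector \<Rightarrow> 'y) \<Rightarrow> ('z \<Rightarrow>\<^sub>L ('x \<Rightarrow>\<^sub>L 'y)) set" where
  "operators2 sZ sX sY =
     {S. (\<forall>z. blinfun_apply S z \<in> operators sX sY) \<and>
         (\<forall>x. Vector_Spaces.linear sZ sY (\<lambda>z. blinfun_apply (blinfun_apply S z) x))}"

definition dual :: "('k::real_or_complex \<Rightarrow> 'x::real_normed_vector \<Rightarrow> 'x) \<Rightarrow> ('x \<Rightarrow>\<^sub>L 'k) set" where
  "dual sX = operators sX (*)"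


section \<open>Summable sequences\<close>

text \<open>Indices \<open>p \<in> [1, \<infinity>]\<close> are extended reals; \<open>conjugate p\<close> is \<open>p'\<close>.\<close>

definition conjugate :: "ennreal \<Rightarrow> ennreal" where
  "conjugate p = inverse (1 - inverse p)"

lemma conjugate:
  assumes "1 \<le> p"
  shows "1 / p + 1 / q = 1 \<longleftrightarrow> q = conjugate p"
proof -
  have le: "inverse p \<le> 1"
  proof (cases p)
    case (real r)
    with assms have "1 \<le> r" by simp
    then show ?thesis using real by (simp add: inverse_ennreal inverse_le_1_iff)
  qed simp
  have inv: "inverse (inverse a) = a" for a :: ennreal
  proof (cases a)
    case (real r)
    then show ?thesis by (cases "r = 0") (simp_all add: inverse_ennreal)
  qed simp
  have "1 / p + 1 / q = 1 \<longleftrightarrow> inverse p + inverse q = 1"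
    by (simp add: divide_ennreal_def)
  also have "\<dots> \<longleftrightarrow> inverse q = 1 - inverse p"
    using le by (metis add_diff_inverse_ennreal ennreal_add_diff_cancel_left
        ennreal_one_less_top less_le_not_le)
  also have "\<dots> \<longleftrightarrow> q = conjugate p"
    unfolding conjugate_def by (metis inv)
  finally show ?thesis .
qed

text \<open>
  The \<open>\<ell>\<^sub>q\<close>-norm, with value \<open>\<infinity>\<close> if the system is not \<open>q\<close>-summable, of a system
  indexed by \<open>I\<close>: a finite system is \<open>I = {..<n}\<close>, a sequence \<open>I = UNIV\<close>, and the tail
  starting at \<open>n\<close> is \<open>I = {n..}\<close>. Sequences are indexed from 0.
\<close>

definition strong_norm :: "ennreal \<Rightarrow> nat set \<Rightarrow> (nat \<Rightarrow> 'x::real_normed_vector) \<Rightarrow> ennreal" where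
  "strong_norm q I x =
     (if q = \<infinity> then (SUP i\<in>I. ennreal (norm (x i)))
      else let r = enn2real q; s = (\<Sum>\<^sub>\<infinity>i\<in>I. ennreal (norm (x i) powr r))
           in if s = \<infinity> then \<infinity> else ennreal (enn2real s powr (1 / r)))"

definition weak_norm ::
  "('k::real_or_complex \<Rightarrow> 'x::real_normed_vector \<Rightarrow> 'x) \<Rightarrow> ennreal \<Rightarrow> nat set \<Rightarrow> (nat \<Rightarrow> 'x) \<Rightarrow> ennreal" where
  "weak_norm sX q I x =
     (SUP f\<in>{f \<in> dual sX. norm f \<le> 1}. strong_norm q I (\<lambda>i. blinfun_apply f (x i)))"

definition weakly_summable ::
  "('k::real_or_complex \<Rightarrow> 'x::real_normed_vector \<Rightarrow> 'x) \<Rightarrow> ennreal \<Rightarrow> (nat \<Rightarrow> 'x) set" where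
  "weakly_summable sX q =
     {x. \<forall>f\<in>dual sX. strong_norm q UNIV (\<lambda>i. blinfun_apply f (x i)) < \<infinity>}"

definition unconditionally_summable ::
  "('k::real_or_complex \<Rightarrow> 'x::real_normed_vector \<Rightarrow> 'x) \<Rightarrow> ennreal \<Rightarrow> (nat \<Rightarrow> 'x) set" where
  "unconditionally_summable sX q =
     {x \<in> weakly_summable sX q.
        (\<lambda>N. weak_norm sX q UNIV (\<lambda>i. x i - (if i < N then x i else 0))) \<longlonglongrightarrow> 0}"


section \<open>The tensor product and the Chevet--Saphar norm\<close>

definition bilinear_form ::
  "('k::real_or_complex \<Rightarrow> 'z::real_normed_vector \<Rightarrow> 'z) \<Rightarrow> ('k \<Rightarrow> 'x::real_normed_vector \<Rightarrow> 'x) \<Rightarrow>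
   ('z \<Rightarrow> 'x \<Rightarrow> 'k) \<Rightarrow> bool" where
  "bilinear_form sZ sX B \<longleftrightarrow>
     (\<forall>z. Vector_Spaces.linear sX (*) (B z)) \<and>
     (\<forall>x. Vector_Spaces.linear sZ (*) (\<lambda>z. B z x))"

text \<open>
  The algebraic tensor product \<open>Z \<otimes> X\<close> is realized inside the algebraic dual of the space of all
  bilinear forms on \<open>Z \<times> X\<close>, as the set of finite sums of the evaluations
  \<open>z \<otimes> x : B \<mapsto> B z x\<close>. Since \<open>'z \<Rightarrow> 'x \<Rightarrow> 'k\<close> also contains maps that are not bilinear,
  the evaluations are extended to those by 0.
\<close>

type_synonym ('k, 'z, 'x) tensor = "('z \<Rightarrow> 'x \<Rightarrow> 'k) \<Rightarrow> 'k"

definition tensor ::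
  "('k::real_or_complex \<Rightarrow> 'z::real_normed_vector \<Rightarrow> 'z) \<Rightarrow> ('k \<Rightarrow> 'x::real_normed_vector \<Rightarrow> 'x) \<Rightarrow>
   'z \<Rightarrow> 'x \<Rightarrow> ('k, 'z, 'x) tensor" where
  "tensor sZ sX z x = (\<lambda>B. if bilinear_form sZ sX B then B z x else 0)"

definition tensor_scale :: "'k::real_or_complex \<Rightarrow> ('k, 'z, 'x) tensor \<Rightarrow> ('k, 'z, 'x) tensor" where
  "tensor_scale a u = (\<lambda>B. a * u B)"

definition tensor_space ::
  "('k::real_or_complex \<Rightarrow> 'z::real_normed_vector \<Rightarrow> 'z) \<Rightarrow> ('k \<Rightarrow> 'x::real_normed_vector \<Rightarrow> 'x) \<Rightarrow>
   ('k, 'z, 'x) tensor set" where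
  "tensor_space sZ sX = {\<Sum>i<n. tensor sZ sX (z i) (x i) |(n::nat) z x. True}"

text \<open>The norm \<open>d\<^sub>p\<close>; the infimum is finite on \<open>Z \<otimes> X\<close>.\<close>

definition chevet_saphar ::
  "('k::real_or_complex \<Rightarrow> 'z::real_normed_vector \<Rightarrow> 'z) \<Rightarrow> ('k \<Rightarrow> 'x::real_normed_vector \<Rightarrow> 'x) \<Rightarrow>
   ennreal \<Rightarrow> ('k, 'z, 'x) tensor \<Rightarrow> real" where
  "chevet_saphar sZ sX p u =
     enn2real (Inf {weak_norm sZ (conjugate p) {..<n} z * strong_norm p {..<n} x |n z x.
                      u = (\<Sum>i<n. tensor sZ sX (z i) (x i))})"


section \<open>Completion of a normed space\<close>

text \<open>
  The completion of a vector space \<open>E\<close> (a subset of a type, with scalar multiplication \<open>sE\<close>)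
  with norm \<open>\<nu>\<close>: Cauchy sequences in \<open>E\<close> modulo null sequences. The operations are computed on
  representatives; they do not depend on the representative.
\<close>

definition cauchy_seqs :: "'v::ab_group_add set \<Rightarrow> ('v \<Rightarrow> real) \<Rightarrow> (nat \<Rightarrow> 'v) set" where
  "cauchy_seqs E \<nu> =
     {u. range u \<subseteq> E \<and> (\<forall>e>0. \<exists>N. \<forall>m\<ge>N. \<forall>n\<ge>N. \<nu> (u m - u n) < e)}"

definition cauchy_class ::
  "'v::ab_group_add set \<Rightarrow> ('v \<Rightarrow> real) \<Rightarrow> (nat \<Rightarrow> 'v) \<Rightarrow> (nat \<Rightarrow> 'v) set" where
  "cauchy_class E \<nu> u = {v \<in> cauchy_seqs E \<nu>. (\<lambda>n. \<nu> (u n - v n)) \<longlonglongrightarrow> 0}"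

definition completion :: "'v::ab_group_add set \<Rightarrow> ('v \<Rightarrow> real) \<Rightarrow> (nat \<Rightarrow> 'v) set set" where
  "completion E \<nu> = cauchy_class E \<nu> ` cauchy_seqs E \<nu>"

definition representative :: "(nat \<Rightarrow> 'v) set \<Rightarrow> nat \<Rightarrow> 'v" where
  "representative A = (SOME u. u \<in> A)"

definition completion_add ::
  "'v::ab_group_add set \<Rightarrow> ('v \<Rightarrow> real) \<Rightarrow> (nat \<Rightarrow> 'v) set \<Rightarrow> (nat \<Rightarrow> 'v) set \<Rightarrow> (nat \<Rightarrow> 'v) set" where
  "completion_add E \<nu> A B = cauchy_class E \<nu> (\<lambda>n. representative A n + representative B n)"

definition completion_scale ::
  "('k \<Rightarrow> 'v \<Rightarrow> 'v) \<Rightarrow> 'v::ab_group_add set \<Rightarrow> ('v \<Rightarrow> real) \<Rightarrow> 'k \<Rightarrow> (nat \<Rightarrow> 'v) set \<Rightarrow> (nat \<Rightarrow> 'v) set" where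
  "completion_scale sE E \<nu> a A = cauchy_class E \<nu> (\<lambda>n. sE a (representative A n))"

definition completion_norm :: "('v \<Rightarrow> real) \<Rightarrow> (nat \<Rightarrow> 'v) set \<Rightarrow> real" where
  "completion_norm \<nu> A = lim (\<lambda>n. \<nu> (representative A n))"

definition completion_embed :: "'v::ab_group_add set \<Rightarrow> ('v \<Rightarrow> real) \<Rightarrow> 'v \<Rightarrow> (nat \<Rightarrow> 'v) set" where
  "completion_embed E \<nu> e = cauchy_class E \<nu> (\<lambda>_. e)"

text \<open>Bounded linear operators from the completion to \<open>Y\<close>; values off the completion are irrelevant.\<close>

definition completion_operators ::
  "('k::real_or_complex \<Rightarrow> 'v \<Rightarrow> 'v) \<Rightarrow> 'v::ab_group_add set \<Rightarrow> ('v \<Rightarrow> real) \<Rightarrow>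
   ('k \<Rightarrow> 'y::real_normed_vector \<Rightarrow> 'y) \<Rightarrow> ((nat \<Rightarrow> 'v) set \<Rightarrow> 'y) set" where
  "completion_operators sE E \<nu> sY =
     {U. (\<forall>A\<in>completion E \<nu>. \<forall>B\<in>completion E \<nu>. U (completion_add E \<nu> A B) = U A + U B) \<and>
         (\<forall>a. \<forall>A\<in>completion E \<nu>. U (completion_scale sE E \<nu> a A) = sY a (U A)) \<and>
         (\<exists>C. \<forall>A\<in>completion E \<nu>. norm (U A) \<le> C * completion_norm \<nu> A)}"


section \<open>Operators on the completed tensor product\<close>

text \<open>\<open>\<L>(Z \<otimes>\<^sub>d\<^sub>p X, Y)\<close> (completed tensor product) and the associated operator \<open>U\<^sup>#\<close>.\<close>

definition tensor_operators ::
  "('k::real_or_complex \<Rightarrow> 'z::real_normed_vector \<Rightarrow> 'z) \<Rightarrow> ('k \<Rightarrow> 'x::real_normed_vector \<Rightarrow> 'x) \<Rightarrow>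
   ('k \<Rightarrow> 'y::real_normed_vector \<Rightarrow> 'y) \<Rightarrow> ennreal \<Rightarrow> ((nat \<Rightarrow> ('k, 'z, 'x) tensor) set \<Rightarrow> 'y) set" where
  "tensor_operators sZ sX sY p =
     completion_operators tensor_scale (tensor_space sZ sX) (chevet_saphar sZ sX p) sY"

definition associated ::
  "('k::real_or_complex \<Rightarrow> 'z::real_normed_vector \<Rightarrow> 'z) \<Rightarrow> ('k \<Rightarrow> 'x::real_normed_vector \<Rightarrow> 'x) \<Rightarrow>
   ennreal \<Rightarrow> ((nat \<Rightarrow> ('k, 'z, 'x) tensor) set \<Rightarrow> 'y) \<Rightarrow> 'z \<Rightarrow> 'x \<Rightarrow> 'y" where
  "associated sZ sX p U z x =
     U (completion_embed (tensor_space sZ sX) (chevet_saphar sZ sX p) (tensor sZ sX z x))"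

end

(*
  (b) implies (a) because y \<mapsto> norm y is a supremum over the dual unit ball and Hoelder's inequality bounds
  the pairing of (f ((S z_i) e_i)) in l_p' with (norm x_i) in l_p, where x_i = norm x_i * e_i; conversely the
  l_p'-norm of (f ((S z_i) x_i)) is a supremum of the numbers f (U (\<Sum> z_i \<otimes> a_i x_i)) over a in the unit ball of l_p.
  Applied to tails, (b) gives all the statements on sequences. If (b) fails, the normalized
  counterexamples of quality 2^k can be put in disjoint blocks, with sup norm and weak norm at most 2^(-k);
  together they form a null sequence (x_i) and an unconditionally p'-summable (z_i) for
  which ((S z_i) x_i) is not weakly p'-summable, contradicting (c), (d) and (d') at once.
*)

theory Submission
  imports Defs
begin

section \<open>Norms of sequences\<close>

text \<open>Two obstacles shape the proof. Membership in l_p'^w asks for finiteness under each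
  functional separately, while the estimates need a supremum over the dual unit ball. The link is
  uniform boundedness, applied to the sums of a_i x_i over i < n with a in the unit ball of l_p;
  Hahn-Banach over K, Hoelder's inequality and its converse all enter there. The other obstacle is
  that d_p is an infimum over representations. Rescaling z_i by t and x_i by 1/t leaves a tensor
  unchanged, so a value d of the product can be split into d^(1/p') for the z-side and d^(1/p) for
  the x-side; after concatenation the p'-th and p-th powers add, which gives the triangle
  inequality. A map on tensors is independent of the representation because a tensor is determined
  by its values at bilinear forms, among them f ((S z) x) for f in the dual of Y, and these f
  separate points. In the block construction the k-th counterexample violates (b) with the constant
  8^k: two factors 2^k pay for shrinking x and z to size 2^(-k), the third makes the image at least
  2^k.\<close>

lemma strong_norm_infinity_le_iff:
  "0 \<le> t \<Longrightarrow> strong_norm top I x \<le> ennreal t \<longleftrightarrow> (\<forall>i\<in>I. norm (x i) \<le> t)"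
  by (simp add: strong_norm_def SUP_le_iff)

lemma exponent_cases:
  assumes "1 \<le> q"
  obtains "q = top" | r where "1 \<le> r" "q = ennreal r" "q \<noteq> top" "enn2real q = r"
proof (cases q)
  case (real r)
  with assms have "1 \<le> r" by simp
  with real show ?thesis using that(2)[of r] by simp
qed (use that in simp)

text \<open>An infinite sum of nonnegative terms is the supremum of its finite partial sums. This
  form removes \<open>infsum\<close> and extended reals: later estimates for finite exponents are
  about finite real sums.\<close>

lemma strong_norm_finite_le_iff:
  assumes "q \<noteq> top" "enn2real q = r" "1 \<le> r" "0 \<le> t"
  shows "strong_norm q I x \<le> ennreal t \<longleftrightarrow>
    (\<forall>F. finite F \<and> F \<subseteq> I \<longrightarrow> (\<Sum>i\<in>F. norm (x i) powr r) \<le> t powr r)"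
proof -
  define s where "s = (\<Sum>\<^sub>\<infinity>i\<in>I. ennreal (norm (x i) powr r))"
  have "s \<le> ennreal (t powr r) \<longleftrightarrow>
      (\<forall>F. finite F \<and> F \<subseteq> I \<longrightarrow> (\<Sum>i\<in>F. norm (x i) powr r) \<le> t powr r)"
    unfolding s_def by (subst nonneg_infsum_complete) (auto simp: SUP_le_iff sum_nonneg sum_ennreal)
  moreover have "strong_norm q I x \<le> ennreal t \<longleftrightarrow> s \<le> ennreal (t powr r)"
  proof (cases s)
    case (real \<sigma>)
    have "\<sigma> powr (1 / r) \<le> t \<longleftrightarrow> \<sigma> \<le> t powr r"
    proof
      assume "\<sigma> powr (1 / r) \<le> t"
      then have "(\<sigma> powr (1 / r)) powr r \<le> t powr r" using assms by (intro powr_mono2) auto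
      then show "\<sigma> \<le> t powr r" using real assms by (simp add: powr_powr)
    next
      assume "\<sigma> \<le> t powr r"
      then have "\<sigma> powr (1 / r) \<le> (t powr r) powr (1 / r)" using real assms by (intro powr_mono2) auto
      then show "\<sigma> powr (1 / r) \<le> t" using assms by (simp add: powr_powr)
    qed
    with real assms show ?thesis
      by (simp add: strong_norm_def Let_def flip: s_def)
  qed (use assms in \<open>simp add: strong_norm_def Let_def top_unique flip: s_def\<close>)
  ultimately show ?thesis by simp
qed

text \<open>Norms are compared through their finite upper bounds; for infinite \<open>b\<close>
  there is nothing to show.\<close>

lemma ennreal_le_via_real:
  fixes a b :: ennreal
  assumes "\<And>t. 0 \<le> t \<Longrightarrow> b \<le> ennreal t \<Longrightarrow> a \<le> ennreal t"
  shows "a \<le> b"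
  by (cases b) (use assms in auto)

lemma strong_norm_mono:
  assumes "1 \<le> q" "I \<subseteq> J" "\<And>i. i \<in> I \<Longrightarrow> norm (x i) \<le> norm (y i)"
  shows "strong_norm q I x \<le> strong_norm q J y"
proof (rule ennreal_le_via_real)
  fix t :: real assume t: "0 \<le> t" "strong_norm q J y \<le> ennreal t"
  from \<open>1 \<le> q\<close> show "strong_norm q I x \<le> ennreal t"
  proof (cases rule: exponent_cases)
    case 1
    then show ?thesis using t assms by (auto simp: strong_norm_infinity_le_iff intro: order_trans)
  next
    case (2 r)
    have "(\<Sum>i\<in>F. norm (x i) powr r) \<le> t powr r" if "finite F" "F \<subseteq> I" for F
    proof -
      have "(\<Sum>i\<in>F. norm (x i) powr r) \<le> (\<Sum>i\<in>F. norm (y i) powr r)"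
        using that assms 2 by (intro sum_mono powr_mono2) auto
      also have "\<dots> \<le> t powr r"
        using t that assms 2 strong_norm_finite_le_iff[of q r t J y] by auto
      finally show ?thesis .
    qed
    then show ?thesis using 2 t strong_norm_finite_le_iff[of q r t I x] by auto
  qed
qed

lemma strong_norm_cong_norm:
  assumes "1 \<le> q" "\<And>i. i \<in> I \<Longrightarrow> norm (x i) = norm (y i)"
  shows "strong_norm q I x = strong_norm q I y"
  using assms by (intro antisym strong_norm_mono) auto

lemma strong_norm_le_iff_finite_subsets:
  assumes "1 \<le> q" "0 \<le> t"
  shows "strong_norm q I x \<le> ennreal t \<longleftrightarrow>
    (\<forall>F. finite F \<and> F \<subseteq> I \<longrightarrow> strong_norm q F x \<le> ennreal t)"
  using \<open>1 \<le> q\<close>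
proof (cases rule: exponent_cases)
  case 1
  have "(\<forall>i\<in>I. norm (x i) \<le> t) \<longleftrightarrow>
      (\<forall>F. finite F \<and> F \<subseteq> I \<longrightarrow> (\<forall>i\<in>F. norm (x i) \<le> t))" (is "_ \<longleftrightarrow> ?R")
  proof
    assume ?R
    then show "\<forall>i\<in>I. norm (x i) \<le> t"
      by (metis bot_least finite.emptyI finite_insert insert_subset insertI1)
  qed blast
  then show ?thesis unfolding 1 strong_norm_infinity_le_iff[OF assms(2)] .
next
  case (2 r)
  show ?thesis
    unfolding strong_norm_finite_le_iff[OF 2(3,4,1) assms(2)] by (auto dest: subset_trans)
qed

lemma norm_le_strong_norm:
  assumes "1 \<le> q" "i \<in> I"
  shows "ennreal (norm (x i)) \<le> strong_norm q I x"
proof (rule ennreal_le_via_real)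
  fix t :: real assume t: "0 \<le> t" "strong_norm q I x \<le> ennreal t"
  from \<open>1 \<le> q\<close> show "ennreal (norm (x i)) \<le> ennreal t"
  proof (cases rule: exponent_cases)
    case 1
    then show ?thesis using t assms by (auto simp: strong_norm_infinity_le_iff)
  next
    case (2 r)
    have "(\<Sum>i\<in>{i}. norm (x i) powr r) \<le> t powr r"
      using strong_norm_finite_le_iff[OF 2(3,4,1) t(1), of I x] t(2) \<open>i \<in> I\<close>
      by (metis empty_subsetI finite.emptyI finite_insert insert_subset)
    then have "norm (x i) powr r \<le> t powr r" by simp
    then have "norm (x i) \<le> t" using 2 t(1)
      by (smt (verit, ccfv_SIG) norm_ge_zero powr_less_mono2)
    then show ?thesis by (simp add: ennreal_leI)
  qed
qed

text \<open>Valid for \<open>q = \<infinity>\<close> too, where \<open>1/q = 0\<close>.\<close>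
lemma strong_norm_Un_powr:
  assumes q: "1 \<le> q" and e: "e = enn2real (inverse q)" and ab: "0 < a" "0 < b"
    and I: "strong_norm q I x \<le> ennreal (a powr e)" and J: "strong_norm q J x \<le> ennreal (b powr e)"
  shows "strong_norm q (I \<union> J) x \<le> ennreal ((a + b) powr e)"
  using q
proof (cases rule: exponent_cases)
  case 1
  then show ?thesis using I J ab e strong_norm_infinity_le_iff[of 1 _ x] by auto
next
  case (2 r)
  have e: "e = 1 / r" using 2 e by (simp add: inverse_ennreal inverse_eq_divide)
  note le = strong_norm_finite_le_iff[OF 2(3,4,1)]
  have "(\<Sum>i\<in>F. norm (x i) powr r) \<le> a + b" if F: "finite F" "F \<subseteq> I \<union> J" for F
  proof -
    have "(\<Sum>i\<in>F. norm (x i) powr r) = (\<Sum>i\<in>F \<inter> I. norm (x i) powr r) + (\<Sum>i\<in>F - I. norm (x i) powr r)"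
      using F by (metis sum.Int_Diff)
    also have "(\<Sum>i\<in>F \<inter> I. norm (x i) powr r) \<le> (a powr e) powr r"
      using I le[of "a powr e" I x] F by auto
    also have "(\<Sum>i\<in>F - I. norm (x i) powr r) \<le> (b powr e) powr r"
      using J le[of "b powr e" J x] F by auto
    finally show ?thesis using ab 2 by (simp add: powr_powr e)
  qed
  then show ?thesis using le[of "(a + b) powr e" "I \<union> J" x] ab 2 by (simp add: powr_powr e)
qed

text \<open>The r-th powers add when \<open>F\<close> is split into \<open>F \<inter> I\<close> and
  \<open>F - I\<close>, and t^r is superadditive for r \<ge> 1. Cruder than
  \<open>strong_norm_Un_powr\<close>, but sufficient for blocks with geometrically decreasing
  norms.\<close>

lemma strong_norm_Un_le:
  assumes q: "1 \<le> q"
  shows "strong_norm q (I \<union> J) x \<le> strong_norm q I x + strong_norm q J x"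
proof -
  have *: "strong_norm q (I \<union> J) x \<le> ennreal (\<alpha> + \<beta>)"
    if I: "strong_norm q I x \<le> ennreal \<alpha>" and J: "strong_norm q J x \<le> ennreal \<beta>"
      and ab: "0 \<le> \<alpha>" "0 \<le> \<beta>" for \<alpha> \<beta>
    using q
  proof (cases rule: exponent_cases)
    case 1
    then have "norm (x i) \<le> \<alpha> + \<beta>" if "i \<in> I \<union> J" for i
      using I J ab that by (fastforce simp: strong_norm_infinity_le_iff)
    then show ?thesis using 1 ab by (simp add: strong_norm_infinity_le_iff del: ennreal_plus)
  next
    case (2 r)
    note le = strong_norm_finite_le_iff[OF 2(3,4,1)]
    have "(\<Sum>i\<in>F. norm (x i) powr r) \<le> (\<alpha> + \<beta>) powr r" if F: "finite F" "F \<subseteq> I \<union> J" for F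
    proof -
      have "(\<Sum>i\<in>F. norm (x i) powr r) = (\<Sum>i\<in>F \<inter> I. norm (x i) powr r) + (\<Sum>i\<in>F - I. norm (x i) powr r)"
        using F by (metis sum.Int_Diff)
      also have "(\<Sum>i\<in>F \<inter> I. norm (x i) powr r) \<le> \<alpha> powr r"
        using I le[of \<alpha> I x] F ab by auto
      also have "(\<Sum>i\<in>F - I. norm (x i) powr r) \<le> \<beta> powr r"
        using J le[of \<beta> J x] F ab by auto
      also have "\<alpha> powr r + \<beta> powr r \<le> (\<alpha> + \<beta>) powr r"
      proof (cases "\<alpha> + \<beta> = 0")
        case True
        then have "\<alpha> = 0" "\<beta> = 0" using ab by auto
        then show ?thesis by simp
      next
        case False
        then have s: "0 < \<alpha> + \<beta>" using ab by simp
        \<comment> \<open>The quotient \<open>\<gamma> / (\<alpha> + \<beta>)\<close> lies in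
          [0, 1], where t^r \<le> t. For \<open>\<alpha>\<close> and \<open>\<beta>\<close> the two
          quotients sum to 1.\<close>
        have "\<gamma> powr r \<le> \<gamma> / (\<alpha> + \<beta>) * (\<alpha> + \<beta>) powr r" if "0 \<le> \<gamma>" "\<gamma> \<le> \<alpha> + \<beta>" for \<gamma>
        proof -
          have "(\<gamma> / (\<alpha> + \<beta>)) powr r \<le> (\<gamma> / (\<alpha> + \<beta>)) powr 1"
            using that s 2 by (intro powr_mono') (auto simp: field_simps)
          then have "\<gamma> powr r / (\<alpha> + \<beta>) powr r \<le> \<gamma> / (\<alpha> + \<beta>)"
            using that s by (simp add: powr_divide)
          then show ?thesis using s by (simp add: field_simps)
        qed
        from this[of \<alpha>] this[of \<beta>] ab s show ?thesis
          by (smt (verit, ccfv_SIG) add_divide_distrib distrib_right divide_self_if mult_cancel_right1)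
      qed
      finally show ?thesis by simp
    qed
    then show ?thesis using le[of "\<alpha> + \<beta>" "I \<union> J" x] ab by simp
  qed
  show ?thesis
  proof (cases "strong_norm q I x = top \<or> strong_norm q J x = top")
    case False
    then show ?thesis
      using *[of "enn2real (strong_norm q I x)" "enn2real (strong_norm q J x)"]
      by (simp add: less_top ennreal_plus[symmetric] del: ennreal_plus)
        (simp add: ennreal_plus)
  qed auto
qed

lemma strong_norm_empty [simp]:
  assumes "1 \<le> q"
  shows "strong_norm q {} x = 0"
  using assms
proof (cases rule: exponent_cases)
  case 1
  then show ?thesis by (simp add: strong_norm_def bot_ennreal)
next
  case (2 r)
  then show ?thesis by (simp add: strong_norm_def)
qed

lemma strong_norm_UN_le:
  assumes "1 \<le> q" "finite K"
  shows "strong_norm q (\<Union>k\<in>K. I k) x \<le> (\<Sum>k\<in>K. strong_norm q (I k) x)"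
  using \<open>finite K\<close>
proof induction
  case empty
  then show ?case using assms by simp
next
  case (insert k K)
  then show ?case
    using strong_norm_Un_le[OF \<open>1 \<le> q\<close>, of "I k" "\<Union>k\<in>K. I k" x] by (auto intro: order_trans add_left_mono)
qed

lemma strong_norm_zero:
  assumes "1 \<le> q" "\<And>i. i \<in> I \<Longrightarrow> x i = 0"
  shows "strong_norm q I x = 0"
proof -
  have "strong_norm q I x \<le> ennreal 0"
    using \<open>1 \<le> q\<close>
  proof (cases rule: exponent_cases)
    case 1
    then show ?thesis using assms by (subst 1, subst strong_norm_infinity_le_iff) auto
  next
    case (2 r)
    then show ?thesis using assms by (subst strong_norm_finite_le_iff[of q r]) (auto simp: subset_iff)
  qed
  then show ?thesis by simp
qed

lemma strong_norm_finite:
  assumes "1 \<le> q" "finite I"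
  shows "strong_norm q I x < top"
proof -
  have "strong_norm q {i} x < top" for i
    using \<open>1 \<le> q\<close>
  proof (cases rule: exponent_cases)
    case 1
    then show ?thesis by (simp add: strong_norm_def)
  next
    case (2 r)
    then show ?thesis by (simp add: strong_norm_def)
  qed
  then have "(\<Sum>i\<in>I. strong_norm q {i} x) < top" using \<open>finite I\<close> by simp
  then show ?thesis using strong_norm_UN_le[OF assms, of "\<lambda>i. {i}" x] by (auto intro: le_less_trans)
qed

lemma strong_norm_reindex:
  assumes q: "1 \<le> q" and f: "inj_on f I"
  shows "strong_norm q (f ` I) x = strong_norm q I (\<lambda>i. x (f i))"
  using infsum_reindex[OF f, of "\<lambda>i. ennreal (norm (x i) powr enn2real q)"]
  by (simp add: strong_norm_def Let_def o_def image_image)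

lemma strong_norm_scale_le:
  assumes q: "1 \<le> q" and c: "0 \<le> c" and xy: "\<And>i. i \<in> I \<Longrightarrow> norm (x i) \<le> c * norm (y i)"
  shows "strong_norm q I x \<le> ennreal c * strong_norm q I y"
proof (cases "strong_norm q I y")
  case (real t)
  have "strong_norm q I x \<le> ennreal (c * t)"
    using q
  proof (cases rule: exponent_cases)
    case 1
    have "norm (y i) \<le> t" if "i \<in> I" for i
      using 1 real that strong_norm_infinity_le_iff[of t I y] by auto
    then have "norm (x i) \<le> c * t" if "i \<in> I" for i
      using xy[OF that] that c by (meson mult_left_mono order_trans)
    then show ?thesis using 1 c real by (simp add: strong_norm_infinity_le_iff)
  next
    case (2 r)
    have "(\<Sum>i\<in>F. norm (x i) powr r) \<le> (c * t) powr r" if F: "finite F" "F \<subseteq> I" for F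
    proof -
      have "(\<Sum>i\<in>F. norm (x i) powr r) \<le> (\<Sum>i\<in>F. (c * norm (y i)) powr r)"
        using F xy 2 by (intro sum_mono powr_mono2) auto
      also have "\<dots> = c powr r * (\<Sum>i\<in>F. norm (y i) powr r)"
        using c by (simp add: powr_mult sum_distrib_left)
      also have "\<dots> \<le> c powr r * t powr r"
        using strong_norm_finite_le_iff[OF 2(3,4,1), of t I y] real F by (intro mult_left_mono) auto
      finally show ?thesis using c real by (simp add: powr_mult)
    qed
    then show ?thesis using c real strong_norm_finite_le_iff[OF 2(3,4,1), of "c * t" I x] by simp
  qed
  then show ?thesis using real c by (simp add: ennreal_mult)
next
  case top
  show ?thesis
  proof (cases "c = 0")
    \<comment> \<open>In \<open>ennreal\<close>, \<open>0 * top = 0\<close>, so the left side has to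
      vanish here; it does, since every \<open>x i\<close> with \<open>i\<close> in \<open>I\<close>
      has norm at most 0.\<close>
    case True
    then have "strong_norm q I x = 0" using xy by (intro strong_norm_zero q) auto
    then show ?thesis by simp
  qed (use top c in \<open>simp add: ennreal_mult_top\<close>)
qed

section \<open>Conjugate exponents, Hoelder's inequality and its converse\<close>

lemma conjugate_cases:
  assumes "1 \<le> p"
  obtains "p = 1" "conjugate p = top" | "p = top" "conjugate p = 1"
  | r s where "1 < r" "1 < s" "1 / r + 1 / s = 1" "p = ennreal r" "p \<noteq> top" "enn2real p = r"
      "conjugate p = ennreal s" "conjugate p \<noteq> top" "enn2real (conjugate p) = s"
proof (cases p)
  case (real r)
  with assms have r: "1 \<le> r" by simp
  show ?thesis
  proof (cases "r = 1")
    case True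
    then show ?thesis using that(1) real by (simp add: conjugate_def)
  next
    case False
    then have r: "1 < r" using r by simp
    define s where "s = r / (r - 1)"
    have s: "1 < s" "1 / r + 1 / s = 1" "1 - 1 / r = 1 / s" "s > 0"
      using r by (auto simp: s_def field_simps)
    have "inverse p = ennreal (1 / r)" using r real by (simp add: inverse_ennreal inverse_eq_divide)
    then have "1 - inverse p = ennreal (1 / s)"
      using r s by (metis ennreal_1 ennreal_minus s(3) zero_le_divide_1_iff less_imp_le order_less_trans zero_less_one)
    then have "conjugate p = ennreal s"
      unfolding conjugate_def using s by (simp add: inverse_ennreal)
    then show ?thesis using that(3)[of r s] r s real by simp
  qed
next
  case top
  then show ?thesis using that(2) by (simp add: conjugate_def)
qed

lemma conjugate_ge_1: "1 \<le> p \<Longrightarrow> 1 \<le> conjugate p"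
  by (erule conjugate_cases) auto

text \<open>With \<open>inverse top = 0\<close> this is 1/p' + 1/p = 1 at the endpoints too. It
  allows splitting d > 0 as d^(1/p') * d^(1/p) without distinguishing cases.\<close>

lemma inverse_conjugate_sum:
  "1 \<le> p \<Longrightarrow> enn2real (inverse (conjugate p)) + enn2real (inverse p) = 1"
  by (erule conjugate_cases) (auto simp: inverse_ennreal inverse_eq_divide)

lemma strong_norm_1_le_iff:
  assumes "finite F" "0 \<le> t"
  shows "strong_norm 1 F x \<le> ennreal t \<longleftrightarrow> (\<Sum>i\<in>F. norm (x i)) \<le> t"
proof -
  have "(\<Sum>i\<in>G. norm (x i)) \<le> (\<Sum>i\<in>F. norm (x i))" if "G \<subseteq> F" for G
    using that assms by (intro sum_mono2) auto
  then show ?thesis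
    using strong_norm_finite_le_iff[of 1 1 t F x] assms by (auto intro: order_trans)
qed

text \<open>Strictly between the endpoints, Young's inequality is applied to the terms divided by
  \<open>A\<close> and \<open>C\<close>, and the resulting bounds sum to at most 1/r + 1/s = 1. If
  \<open>A\<close> or \<open>C\<close> is 0, every term of that sequence vanishes.\<close>

lemma holder_sum:
  fixes a :: "nat \<Rightarrow> 'a::real_normed_vector" and c :: "nat \<Rightarrow> 'b::real_normed_vector"
  assumes p: "1 \<le> p" and F: "finite F" and AC: "0 \<le> A" "0 \<le> C"
    and a: "strong_norm p F a \<le> ennreal A" and c: "strong_norm (conjugate p) F c \<le> ennreal C"
  shows "(\<Sum>i\<in>F. norm (a i) * norm (c i)) \<le> A * C"
  using p
proof (cases rule: conjugate_cases)
  case 1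
  have "(\<Sum>i\<in>F. norm (a i) * norm (c i)) \<le> (\<Sum>i\<in>F. norm (a i) * C)"
    using c 1 AC by (intro sum_mono mult_left_mono) (auto simp: strong_norm_infinity_le_iff)
  also have "\<dots> \<le> A * C"
    using a 1 AC F by (auto simp: strong_norm_1_le_iff simp flip: sum_distrib_right intro: mult_right_mono)
  finally show ?thesis .
next
  case 2
  have "(\<Sum>i\<in>F. norm (a i) * norm (c i)) \<le> (\<Sum>i\<in>F. A * norm (c i))"
    using a 2 AC by (intro sum_mono mult_right_mono) (auto simp: strong_norm_infinity_le_iff)
  also have "\<dots> \<le> A * C"
    using c 2 AC F by (auto simp: strong_norm_1_le_iff simp flip: sum_distrib_left intro: mult_left_mono)
  finally show ?thesis .
next
  case (3 r s)
  have sa: "(\<Sum>i\<in>F. norm (a i) powr r) \<le> A powr r"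
    using a strong_norm_finite_le_iff[of p r A F a] 3 F AC by auto
  have sc: "(\<Sum>i\<in>F. norm (c i) powr s) \<le> C powr s"
    using c strong_norm_finite_le_iff[of "conjugate p" s C F c] 3 F AC by auto
  consider "A = 0" | "C = 0" | "0 < A" "0 < C" using AC by fastforce
  then show ?thesis
  proof cases
    assume "A = 0"
    then have "a i = 0" if "i \<in> F" for i
      using norm_le_strong_norm[OF p that, of a] a by simp
    then show ?thesis using AC by simp
  next
    assume "C = 0"
    then have "c i = 0" if "i \<in> F" for i
      using norm_le_strong_norm[OF conjugate_ge_1[OF p] that, of c] c by simp
    then show ?thesis using AC by simp
  next
    assume AC: "0 < A" "0 < C"
    have "norm (a i) / A * (norm (c i) / C) \<le>
        norm (a i) powr r / A powr r / r + norm (c i) powr s / C powr s / s" for i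
      using Youngs_inequality[of r s "norm (a i) / A" "norm (c i) / C"] 3 AC
      by (simp add: powr_divide)
    then have "(\<Sum>i\<in>F. norm (a i) / A * (norm (c i) / C)) \<le>
        (\<Sum>i\<in>F. norm (a i) powr r / A powr r / r + norm (c i) powr s / C powr s / s)"
      by (intro sum_mono)
    also have "\<dots> = (\<Sum>i\<in>F. norm (a i) powr r) / A powr r / r + (\<Sum>i\<in>F. norm (c i) powr s) / C powr s / s"
      by (simp add: sum.distrib sum_divide_distrib)
    also have "\<dots> \<le> 1 / r + 1 / s"
      using sa sc AC 3 by (intro add_mono divide_right_mono) (auto simp: divide_le_eq)
    finally have "(\<Sum>i\<in>F. norm (a i) * norm (c i)) / (A * C) \<le> 1"
      using 3 by (simp add: sum_divide_distrib)
    then show ?thesis using AC by (simp add: divide_le_eq)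
  qed
qed

text \<open>Converse of Hoelder's inequality, by testing with extremal coefficients: unit vectors if
  p = 1, the phases \<open>u\<close> if p = \<infinity>, and otherwise the phases weighted by
  |c_i|^(s-1) and normalized in l_r.\<close>

lemma strong_norm_dual_le:
  fixes c :: "nat \<Rightarrow> 'k::real_normed_field"
  assumes p: "1 \<le> p" and F: "finite F" and C: "0 \<le> C"
    and dual: "\<And>a :: nat \<Rightarrow> 'k. strong_norm p F a \<le> 1 \<Longrightarrow> norm (\<Sum>i\<in>F. a i * c i) \<le> C"
  shows "strong_norm (conjugate p) F c \<le> ennreal C"
proof -
  \<comment> \<open>The inverse phase of \<open>c i\<close>: it rotates \<open>c i\<close> to its
    absolute value, over either field.\<close>
  define u where "u i = (if c i = 0 then 0 else of_real (norm (c i)) / c i)" for i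
  have uc: "u i * c i = of_real (norm (c i))" for i by (simp add: u_def)
  have nu: "norm (u i) \<le> 1" for i by (simp add: u_def norm_divide)
  show ?thesis
    using p
  proof (cases rule: conjugate_cases)
    case 1
    have "norm (c j) \<le> C" if j: "j \<in> F" for j
    proof -
      let ?a = "\<lambda>i. if i = j then 1 else (0::'k)"
      have n: "norm (?a i) = (if i = j then 1 else 0)" for i by simp
      have "(\<Sum>i\<in>F. norm (?a i)) = 1"
        unfolding n using F j by simp
      then have "strong_norm p F ?a \<le> 1"
        using strong_norm_1_le_iff[OF F, of 1 ?a] 1 by simp
      from dual[OF this] show ?thesis using F j by (simp add: if_distrib[of "\<lambda>a. a * _"] cong: if_cong)
    qed
    then show ?thesis using 1 C by (simp add: strong_norm_infinity_le_iff)
  next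
    case 2
    have "strong_norm p F u \<le> 1"
      using strong_norm_infinity_le_iff[of 1 F u] 2 nu by simp
    from dual[OF this] have "norm (of_real (\<Sum>i\<in>F. norm (c i)) :: 'k) \<le> C"
      by (simp add: uc)
    then have "(\<Sum>i\<in>F. norm (c i)) \<le> C"
      unfolding norm_of_real by linarith
    then show ?thesis using 2 C strong_norm_1_le_iff[OF F C, of c] by simp
  next
    case (3 r s)
    define M where "M = (\<Sum>i\<in>F. norm (c i) powr s)"
    have M0: "0 \<le> M" by (simp add: M_def sum_nonneg)
    have rs: "(s - 1) * r = s" using 3 by (simp add: field_simps)
    have "M \<le> C powr s"
    proof (cases "M = 0")
      case False
      then have M: "0 < M" using M0 by simp
      \<comment> \<open>Since (s - 1) r = s, the r-th powers of |c_i|^(s-1) sum to \<open>M\<close>,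
        so \<open>N\<close> is their l_r-norm. Pairing the normalized coefficients with
        \<open>c\<close> gives M / N = M^(1/s), which is the l_s-norm of \<open>c\<close>.\<close>
      define N where "N = M powr (1 / r)"
      have N: "0 < N" using M by (simp add: N_def)
      define a where "a i = u i * of_real (norm (c i) powr (s - 1) / N)" for i
      have na: "norm (a i) \<le> norm (c i) powr (s - 1) / N" for i
        using mult_mono[OF nu[of i] order_refl, of "norm (c i) powr (s - 1) / N"] N
        by (simp add: a_def norm_mult norm_divide)
      have "(\<Sum>i\<in>G. norm (a i) powr r) \<le> 1" if "G \<subseteq> F" for G
      proof -
        have "(\<Sum>i\<in>G. norm (a i) powr r) \<le> (\<Sum>i\<in>F. (norm (c i) powr (s - 1) / N) powr r)"
          using that F na 3 by (intro order_trans[OF sum_mono2 sum_mono] powr_mono2) auto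
        also have "\<dots> = (\<Sum>i\<in>F. norm (c i) powr s / M)"
          using N M 3 by (simp add: powr_divide powr_powr rs N_def)
        also have "\<dots> = 1" using M by (simp add: M_def sum_divide_distrib[symmetric])
        finally show ?thesis .
      qed
      then have "strong_norm p F a \<le> ennreal 1"
        using strong_norm_finite_le_iff[of p r 1 F a] 3 by auto
      then have "norm (\<Sum>i\<in>F. a i * c i) \<le> C" using dual by simp
      moreover have "a i * c i = of_real (norm (c i) powr s / N)" for i
      proof -
        have "a i * c i = of_real (norm (c i) powr (s - 1) / N) * (u i * c i)" by (simp add: a_def)
        also have "\<dots> = of_real (norm (c i) powr (s - 1) * norm (c i) / N)" by (simp add: uc)
        also have "norm (c i) powr (s - 1) * norm (c i) = norm (c i) powr s"
          by (cases "c i = 0") (auto simp: powr_diff)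
        finally show ?thesis .
      qed
      ultimately have "norm (of_real (M / N) :: 'k) \<le> C"
        by (simp only: of_real_sum[symmetric] M_def sum_divide_distrib)
      then have "M / N \<le> C" unfolding norm_of_real by linarith
      moreover have "M / N = M powr (1 / s)"
      proof -
        have "M / N = M powr (1 - 1 / r)" using M by (simp add: N_def powr_diff)
        also have "1 - 1 / r = 1 / s" using 3 by linarith
        finally show ?thesis .
      qed
      ultimately have "(M powr (1 / s)) powr s \<le> C powr s" using 3 by (intro powr_mono2) auto
      then show ?thesis using M 3 by (simp add: powr_powr)
    qed auto
    moreover have "(\<Sum>i\<in>G. norm (c i) powr s) \<le> M" if "G \<subseteq> F" for G
      unfolding M_def using that F by (intro sum_mono2) auto
    ultimately show ?thesis
      using strong_norm_finite_le_iff[of "conjugate p" s C F c] 3 C by (meson order_less_imp_le order_trans)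
  qed
qed


section \<open>The Hahn--Banach theorem\<close>

definition sublinear :: "('x::real_vector \<Rightarrow> real) \<Rightarrow> bool" where
  "sublinear q \<longleftrightarrow> (\<forall>x y. q (x + y) \<le> q x + q y) \<and> (\<forall>t\<ge>0. \<forall>x. q (t *\<^sub>R x) = t * q x)"

text \<open>Applying the inequality for t > 0 to 1/t as well gives equality. Infima of sublinear
  functionals satisfy the inequality directly.\<close>

lemma sublinearI:
  assumes add: "\<And>x y. q (x + y) \<le> q x + q y" and zero: "q 0 = 0"
    and scale: "\<And>t x. 0 < t \<Longrightarrow> q (t *\<^sub>R x) \<le> t * q x"
  shows "sublinear q"
proof -
  have "q (t *\<^sub>R x) = t * q x" if "0 \<le> t" for t x
  proof (cases "t = 0")
    case False
    with that have t: "0 < t" by simp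
    have "q x \<le> 1 / t * q (t *\<^sub>R x)" using scale[of "1 / t" "t *\<^sub>R x"] t by simp
    then show ?thesis using scale[OF t, of x] t by (simp add: field_simps)
  qed (simp add: zero)
  with add show ?thesis by (simp add: sublinear_def)
qed

lemma sublinear_add: "sublinear q \<Longrightarrow> q (x + y) \<le> q x + q y"
  and sublinear_scaleR: "sublinear q \<Longrightarrow> 0 \<le> t \<Longrightarrow> q (t *\<^sub>R x) = t * q x"
  by (simp_all add: sublinear_def)

lemma sublinear_zero: "sublinear q \<Longrightarrow> q 0 = 0"
  using sublinear_scaleR[of q 0 0] by simp

lemma sublinear_ge: "sublinear q \<Longrightarrow> - q (- x) \<le> q x"
  using sublinear_add[of q x "- x"] by (simp add: sublinear_zero)

text \<open>A minimal sublinear functional coincides with all its reductions, which makes it additive.\<close>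
definition reduce_along :: "'x::real_vector \<Rightarrow> ('x \<Rightarrow> real) \<Rightarrow> 'x \<Rightarrow> real" where
  "reduce_along y q x = (INF t\<in>{0..}. q (x + t *\<^sub>R y) - t * q y)"

text \<open>Follows from q (t y) \<le> q (x + t y) + q (- x). The bound is independent of
  \<open>t\<close>, so the infimum defining \<open>reduce_along\<close> is over a set bounded
  below.\<close>

lemma reduce_along_ge:
  assumes "sublinear q" "0 \<le> t"
  shows "- q (- x) \<le> q (x + t *\<^sub>R y) - t * q y"
  using sublinear_add[OF assms(1), of "x + t *\<^sub>R y" "- x"] sublinear_scaleR[OF assms, of y] by simp

lemma reduce_along_le:
  assumes "sublinear q" "0 \<le> t"
  shows "reduce_along y q x \<le> q (x + t *\<^sub>R y) - t * q y"
  unfolding reduce_along_def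
  using reduce_along_ge[OF assms(1)] assms(2) by (intro cINF_lower bdd_belowI2) auto

lemma reduce_along_greatest:
  "(\<And>t. 0 \<le> t \<Longrightarrow> c \<le> q (x + t *\<^sub>R y) - t * q y) \<Longrightarrow> c \<le> reduce_along y q x"
  unfolding reduce_along_def by (intro cINF_greatest) auto

text \<open>Parameters s for \<open>x1\<close> and t for \<open>x2\<close> combine to s + t for the
  sum, and scaling by s > 0 replaces t by s t, which runs through the same half-line.\<close>

lemma sublinear_reduce_along:
  assumes q: "sublinear q"
  shows "sublinear (reduce_along y q)"
proof (rule sublinearI)
  show "reduce_along y q (x1 + x2) \<le> reduce_along y q x1 + reduce_along y q x2" for x1 x2
  proof -
    have "reduce_along y q (x1 + x2) - (q (x1 + s *\<^sub>R y) - s * q y) \<le> q (x2 + t *\<^sub>R y) - t * q y"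
      if "0 \<le> s" "0 \<le> t" for s t
      using reduce_along_le[OF q, of "s + t" y "x1 + x2"] that
        sublinear_add[OF q, of "x1 + s *\<^sub>R y" "x2 + t *\<^sub>R y"] by (simp add: algebra_simps)
    then have "reduce_along y q (x1 + x2) - (q (x1 + s *\<^sub>R y) - s * q y) \<le> reduce_along y q x2"
      if "0 \<le> s" for s
      using that by (intro reduce_along_greatest)
    then have "reduce_along y q (x1 + x2) - reduce_along y q x2 \<le> q (x1 + s *\<^sub>R y) - s * q y"
      if "0 \<le> s" for s
      using that by fastforce
    then have "reduce_along y q (x1 + x2) - reduce_along y q x2 \<le> reduce_along y q x1"
      by (intro reduce_along_greatest)
    then show ?thesis by simp
  qed
  show "reduce_along y q 0 = 0"
    using reduce_along_le[OF q, of 0 y 0] reduce_along_ge[OF q, of _ 0 y]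
      reduce_along_greatest[of "- q (- 0)" q 0 y] sublinear_zero[OF q] by auto
  show "reduce_along y q (s *\<^sub>R x) \<le> s * reduce_along y q x" if s: "0 < s" for s x
  proof -
    have "reduce_along y q (s *\<^sub>R x) / s \<le> q (x + t *\<^sub>R y) - t * q y" if "0 \<le> t" for t
    proof -
      have "reduce_along y q (s *\<^sub>R x) \<le> q (s *\<^sub>R (x + t *\<^sub>R y)) - s * t * q y"
        using reduce_along_le[OF q, of "s * t" y "s *\<^sub>R x"] s that by (simp add: algebra_simps)
      then show ?thesis using s sublinear_scaleR[OF q, of s "x + t *\<^sub>R y"] by (simp add: field_simps)
    qed
    then have "reduce_along y q (s *\<^sub>R x) / s \<le> reduce_along y q x"
      by (rule reduce_along_greatest)
    then show ?thesis using s by (simp add: field_simps)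
  qed
qed

lemma reduce_along_le_self: "sublinear q \<Longrightarrow> reduce_along y q x \<le> q x"
  using reduce_along_le[of q 0 y x] by simp

text \<open>The parameter t = 1. When \<open>q\<close> equals its own reduction, this is
  superadditivity, the missing half of additivity.\<close>

lemma reduce_along_uminus: "sublinear q \<Longrightarrow> reduce_along y q (x - y) \<le> q x - q y"
  using reduce_along_le[of q 1 y "x - y"] by simp

text \<open>Zorn's lemma in the reversed pointwise order. A nonempty chain has its pointwise infimum
  as lower bound; the infimum is finite because every sublinear functional below \<open>q0\<close>
  dominates - q0 (- x).\<close>

lemma exists_minimal_sublinear:
  assumes q0: "sublinear q0"
  shows "\<exists>m. sublinear m \<and> m \<le> q0 \<and> (\<forall>q. sublinear q \<and> q \<le> m \<longrightarrow> q = m)"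
proof -
  define A where "A = {q. sublinear q \<and> q \<le> q0}"
  have "\<exists>m\<in>A. \<forall>q\<in>A. q \<le> m \<longrightarrow> q = m"
  proof (rule predicate_Zorn[where P = "\<lambda>a b. b \<le> a"])
    show "partial_order_on A (relation_of (\<lambda>a b. b \<le> a) A)"
      by (auto simp: relation_of_def partial_order_on_def preorder_on_def refl_on_def trans_def antisym_def)
  next
    fix C assume "C \<in> Chains (relation_of (\<lambda>a b. b \<le> a) A)"
    then have CA: "C \<subseteq> A" and tot: "\<And>a b. a \<in> C \<Longrightarrow> b \<in> C \<Longrightarrow> b \<le> a \<or> a \<le> b"
      by (auto simp: Chains_def relation_of_def)
    show "\<exists>u\<in>A. \<forall>a\<in>C. u \<le> a"
    proof (cases "C = {}")
      case True
      then show ?thesis using q0 by (auto simp: A_def)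
    next
      case False
      define u where "u x = (INF q\<in>C. q x)" for x
      have sub: "sublinear q" "q x \<le> q0 x" if "q \<in> C" for q x
        using that CA by (auto simp: A_def le_fun_def)
      have low: "- q0 (- x) \<le> q x" if "q \<in> C" for q x
        using sublinear_ge[OF sub(1)[OF that], of x] sub(2)[OF that, of "- x"] by linarith
      have le: "u x \<le> q x" if "q \<in> C" for q x
        unfolding u_def using that low by (intro cINF_lower bdd_belowI2) auto
      have greatest: "c \<le> u x" if "\<And>q. q \<in> C \<Longrightarrow> c \<le> q x" for c x
        unfolding u_def using that False by (intro cINF_greatest) auto
      have "sublinear u"
      proof (rule sublinearI)
        fix x y
        have "u (x + y) \<le> q1 x + q2 y" if "q1 \<in> C" "q2 \<in> C" for q1 q2
        proof -
          have "u (x + y) \<le> q1 x + q1 y" "u (x + y) \<le> q2 x + q2 y"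
            using le sub(1) sublinear_add that by (meson order_trans)+
          \<comment> \<open>The chain property: if \<open>q2\<close> is the smaller functional, it
            may replace \<open>q1\<close> at \<open>x\<close>; otherwise \<open>q1\<close> may
            replace \<open>q2\<close> at \<open>y\<close>.\<close>
          moreover have "q2 x \<le> q1 x \<or> q1 y \<le> q2 y" using tot[OF that] by (auto simp: le_fun_def)
          ultimately show ?thesis by linarith
        qed
        then have "u (x + y) - q1 x \<le> u y" if "q1 \<in> C" for q1
          using that by (intro greatest) (simp add: diff_le_eq add.commute[of _ "q1 x"])
        then have "u (x + y) - u y \<le> u x"
          by (intro greatest) (simp add: diff_le_eq add.commute)
        then show "u (x + y) \<le> u x + u y" by simp
      next
        show "u 0 = 0" using False by (simp add: u_def sublinear_zero[OF sub(1)] cong: INF_cong)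
      next
        fix t :: real and x assume t: "0 < t"
        have "u (t *\<^sub>R x) / t \<le> q x" if "q \<in> C" for q
          using le[OF that, of "t *\<^sub>R x"] sublinear_scaleR[OF sub(1)[OF that], of t x] t
          by (simp add: field_simps)
        then have "u (t *\<^sub>R x) / t \<le> u x" by (rule greatest)
        then show "u (t *\<^sub>R x) \<le> t * u x" using t by (simp add: field_simps)
      qed
      moreover obtain q where "q \<in> C" using False by auto
      then have "u \<le> q0" using le sub(2) by (meson le_funI order_trans)
      ultimately show ?thesis using le by (auto simp: A_def le_fun_def)
    qed
  qed
  then show ?thesis by (auto simp: A_def intro: order_trans)
qed

text \<open>Hahn-Banach without a subspace to extend from: a prescribed value is obtained by a
  suitable choice of \<open>q\<close>, such as a reduction of the norm.\<close>

lemma dominated_linear_functional: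
  assumes "sublinear q"
  shows "\<exists>l. linear l \<and> (\<forall>x. l x \<le> q x)"
proof -
  obtain m where m: "sublinear m" "m \<le> q" and min: "\<And>r. sublinear r \<Longrightarrow> r \<le> m \<Longrightarrow> r = m"
    using exists_minimal_sublinear[OF assms] by blast
  have red: "reduce_along y m = m" for y
    using m min sublinear_reduce_along reduce_along_le_self by (metis le_funI)
  have add: "m (x + y) = m x + m y" for x y
    using reduce_along_uminus[OF m(1), of y "x + y"] sublinear_add[OF m(1), of x y] red[of y] by simp
  have neg: "m (- x) = - m x" for x
    using add[of x "- x"] sublinear_zero[OF m(1)] by simp
  have "m (t *\<^sub>R x) = t * m x" for t x
  proof (cases "0 \<le> t")
    case False
    then have "m ((- t) *\<^sub>R x) = - t * m x" by (intro sublinear_scaleR[OF m(1)]) simp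
    then show ?thesis using neg[of "t *\<^sub>R x"] by simp
  qed (use sublinear_scaleR[OF m(1)] in simp)
  then have "linear m" using add by (intro linearI) auto
  then show ?thesis using m by (auto simp: le_fun_def)
qed

text \<open>The functional is taken below the reduction of the norm along \<open>v\<close>, not
  merely below the norm: at - v this reduction is at most - norm v, which forces l v \<ge> norm
  v.\<close>

lemma exists_norming_functional:
  fixes v :: "'x::real_normed_vector"
  shows "\<exists>l. linear l \<and> (\<forall>x. \<bar>l x\<bar> \<le> norm x) \<and> l v = norm v"
proof -
  have sub: "sublinear (norm :: 'x \<Rightarrow> real)" by (rule sublinearI) (auto intro: norm_triangle_ineq)
  obtain l where l: "linear l" "\<And>x. l x \<le> reduce_along v norm x"
    using dominated_linear_functional[OF sublinear_reduce_along[OF sub]] by blast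
  have le: "l x \<le> norm x" for x using l(2) reduce_along_le_self[OF sub] by (rule order_trans)
  have neg: "l (- x) = - l x" for x using linear_neg[OF l(1)] by simp
  have "\<bar>l x\<bar> \<le> norm x" for x using le[of x] le[of "- x"] neg[of x] by simp
  moreover have "l v = norm v"
    using l(2)[of "0 - v"] reduce_along_uminus[OF sub, of v 0] neg[of v] le[of v] by simp
  ultimately show ?thesis using l(1) by blast
qed


section \<open>Duality\<close>

lemma vector_space_mult: "vector_space ((*) :: 'k::field \<Rightarrow> 'k \<Rightarrow> 'k)"
  by unfold_locales (simp_all add: algebra_simps)

lemma linear_iff_vector_space:
  "Vector_Spaces.linear s1 s2 f \<longleftrightarrow> vector_space s1 \<and> vector_space s2 \<and>
     (\<forall>x y. f (x + y) = f x + f y) \<and> (\<forall>a x. f (s1 a x) = s2 a (f x))"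
  by (auto simp: Vector_Spaces.linear_def module_hom_def module_hom_axioms_def module_iff_vector_space)

lemma banach_space_vector_space: "banach_space sX \<Longrightarrow> vector_space sX"
  and banach_space_of_real: "banach_space sX \<Longrightarrow> sX (of_real r) x = r *\<^sub>R x"
  and banach_space_norm: "banach_space sX \<Longrightarrow> norm (sX a x) = norm a * norm x"
  by (simp_all add: banach_space_def)

lemma dual_iff:
  assumes "banach_space sX"
  shows "f \<in> dual sX \<longleftrightarrow> (\<forall>a x. blinfun_apply f (sX a x) = a * blinfun_apply f x)"
  using assms
  by (auto simp: dual_def operators_def linear_iff_vector_space vector_space_mult
      banach_space_vector_space blinfun.add_right)

text \<open>Over the complex numbers the functional is \<open>x \<mapsto> l x - \<i> l (\<i> x)\<close>.\<close>
lemma scalar_extension_functional: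
  fixes sX :: "'k::real_or_complex \<Rightarrow> 'x::banach \<Rightarrow> 'x"
  assumes X: "banach_space sX" and l: "linear l" and M: "0 \<le> M" "\<And>x. \<bar>l x\<bar> \<le> M * norm x"
  shows "\<exists>f\<in>dual sX. norm f \<le> M \<and> (\<forall>x. \<bar>l x\<bar> \<le> norm (blinfun_apply f x))"
proof -
  interpret X: vector_space sX by (rule banach_space_vector_space[OF X])
  note la = linear_add[OF l] and ls = linear_scale[OF l, simplified]
  \<comment> \<open>An interface common to both fields. Its last clause says that \<open>l\<close>
    agrees with \<open>g\<close> wherever \<open>g\<close> takes a real value; it takes the place of
    the real part.\<close>
  have "\<exists>g. (\<forall>x y. g (x + y) = g x + g y) \<and> (\<forall>a x. g (sX a x) = a * g x) \<and>
      (\<forall>x. \<bar>l x\<bar> \<le> norm (g x)) \<and> (\<forall>x r. g x = of_real r \<longrightarrow> r = l x)"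
    using real_or_complex[where 'a = 'k]
  proof (elim disjE exE conjE)
    assume real: "\<forall>a::'k. \<exists>r. a = r *\<^sub>R 1"
    have "of_real (l (sX a x)) = a * of_real (l x)" for a x
    proof -
      obtain r where "a = of_real r" using real by (auto simp: of_real_def)
      then show ?thesis by (simp add: banach_space_of_real[OF X] ls)
    qed
    then show ?thesis by (intro exI[of _ "\<lambda>x. of_real (l x)"]) (simp add: la)
  next
    fix i :: 'k
    assume i: "i * i = - 1" and dec: "\<forall>a::'k. \<exists>r s. a = r *\<^sub>R 1 + s *\<^sub>R i"
      and nrm: "\<forall>r s. norm (r *\<^sub>R 1 + s *\<^sub>R i) = sqrt (r\<^sup>2 + s\<^sup>2)"
    have nrm: "norm (of_real r + of_real s * i) = sqrt (r\<^sup>2 + s\<^sup>2)" for r s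
      using nrm by (simp add: scaleR_conv_of_real)
    have dec: "\<exists>r s. a = of_real r + of_real s * i" for a
      using dec by (simp add: scaleR_conv_of_real)
    define g where "g x = of_real (l x) - of_real (l (sX i x)) * i" for x
    have g: "norm (g x) = sqrt ((l x)\<^sup>2 + (l (sX i x))\<^sup>2)" for x
      using nrm[of "l x" "- l (sX i x)"] by (simp add: g_def)
    have re: "r = l x" if "g x = of_real r" for x r
    proof -
      have "of_real (l x - r) + of_real (- l (sX i x)) * i = 0"
        using that by (simp add: g_def) (simp add: algebra_simps)
      then have "sqrt ((l x - r)\<^sup>2 + (- l (sX i x))\<^sup>2) = 0" using nrm by (metis norm_zero)
      then show ?thesis by (simp add: sum_power2_eq_zero_iff)
    qed
    have "g (sX a x) = a * g x" for a x
    proof -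
      obtain r s where a: "a = of_real r + of_real s * i" using dec by blast
      have "l (sX a x) = r * l x + s * l (sX i x)"
        by (simp add: a X.scale_left_distrib la ls banach_space_of_real[OF X] flip: X.scale_scale)
      moreover have "sX i (sX a x) = sX (of_real r) (sX i x) + sX (of_real (- s)) x"
      proof -
        have "i * a = of_real r * i + of_real (- s)" using i by (simp add: a distrib_left mult.left_commute[of i])
        then show ?thesis by (simp only: X.scale_scale X.scale_left_distrib)
      qed
      then have "l (sX i (sX a x)) = r * l (sX i x) - s * l x"
        by (simp only: la ls banach_space_of_real[OF X])
      ultimately have "g (sX a x) = of_real r * of_real (l x) + of_real s * of_real (l (sX i x))
          - (of_real r * of_real (l (sX i x)) - of_real s * of_real (l x)) * i"
        by (simp add: g_def)
      also have "\<dots> = of_real r * g x + of_real s * (i * of_real (l x)) - of_real s * (i * i) * of_real (l (sX i x))"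
        by (simp add: g_def i algebra_simps)
      also have "\<dots> = a * g x" by (simp add: a g_def algebra_simps)
      finally show ?thesis .
    qed
    moreover have "g (x + y) = g x + g y" for x y
      by (simp add: g_def la X.scale_right_distrib algebra_simps)
    moreover have "\<bar>l x\<bar> \<le> norm (g x)" for x
      by (simp add: g real_le_rsqrt)
    ultimately show ?thesis using re by blast
  qed
  then obtain g where add: "\<And>x y. g (x + y) = g x + g y" and scale: "\<And>a x. g (sX a x) = a * g x"
    and ge: "\<And>x. \<bar>l x\<bar> \<le> norm (g x)" and re: "\<And>x r. g x = of_real r \<Longrightarrow> r = l x"
    by blast
  have le: "norm (g x) \<le> M * norm x" for x
  proof (cases "g x = 0")
    case False
    \<comment> \<open>A scalar of absolute value 1 that rotates \<open>g x\<close> onto its absolute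
      value. There \<open>g\<close> is real, so the bound on \<open>l\<close> applies, and the norm
      of the vector is unchanged.\<close>
    define a where "a = of_real (norm (g x)) / g x"
    have "g (sX a x) = of_real (norm (g x))" using False by (simp add: scale a_def)
    then have "norm (g x) = l (sX a x)" by (rule re)
    also have "\<dots> \<le> M * norm (sX a x)" using M(2)[of "sX a x"] by simp
    also have "norm (sX a x) = norm x" using False by (simp add: banach_space_norm[OF X] a_def norm_divide)
    finally show ?thesis .
  qed (use M in simp)
  have bl: "bounded_linear g"
  proof (rule bounded_linear_intro)
    show "g (r *\<^sub>R x) = r *\<^sub>R g x" for r x
      using scale[of "of_real r" x] by (simp add: banach_space_of_real[OF X] scaleR_conv_of_real)
    show "norm (g x) \<le> norm x * M" for x using le by (simp add: mult.commute)
  qed (rule add)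
  have "Blinfun g \<in> dual sX" by (simp add: dual_iff[OF X] bounded_linear_Blinfun_apply[OF bl] scale)
  moreover have "norm (Blinfun g) \<le> M"
    using M le by (intro norm_blinfun_bound) (simp_all add: bounded_linear_Blinfun_apply[OF bl])
  ultimately show ?thesis using ge by (intro bexI[of _ "Blinfun g"]) (simp_all add: bounded_linear_Blinfun_apply[OF bl])
qed

lemma exists_norming_dual:
  fixes sX :: "'k::real_or_complex \<Rightarrow> 'x::banach \<Rightarrow> 'x"
  assumes X: "banach_space sX"
  shows "\<exists>f\<in>dual sX. norm f \<le> 1 \<and> norm v \<le> norm (blinfun_apply f v)"
proof -
  obtain l where l: "linear l" "\<And>x. \<bar>l x\<bar> \<le> norm x" "l v = norm v"
    using exists_norming_functional[of v] by blast
  then obtain f where "f \<in> dual sX" "norm f \<le> 1" "\<And>x. \<bar>l x\<bar> \<le> norm (blinfun_apply f x)"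
    using scalar_extension_functional[OF X, of l 1] by auto
  then show ?thesis using l(3) by (metis abs_norm_cancel)
qed

lemma norm_dual_apply_le:
  "norm f \<le> 1 \<Longrightarrow> norm (blinfun_apply f x) \<le> norm x"
  using norm_blinfun[of f x] mult_right_mono[of "norm f" 1 "norm x"] by simp

lemma dual_separates:
  fixes sX :: "'k::real_or_complex \<Rightarrow> 'x::banach \<Rightarrow> 'x"
  assumes X: "banach_space sX" and "\<And>f. f \<in> dual sX \<Longrightarrow> blinfun_apply f x = blinfun_apply f y"
  shows "x = y"
proof -
  obtain f where "f \<in> dual sX" "norm (x - y) \<le> norm (blinfun_apply f (x - y))"
    using exists_norming_dual[OF X, of "x - y"] by blast
  with assms(2)[of f] show ?thesis by (simp add: blinfun.diff_right)
qed

section \<open>The uniform boundedness principle\<close>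

text \<open>If \<open>norm (v k) > 4^k\<close> for all \<open>k\<close>, then of the two functionals \<open>F k \<plusminus> 3^(-k) g k\<close>,
  where \<open>g k\<close> is norming for \<open>v k\<close>, one has absolute value at least \<open>3^(-k) * norm (v k)\<close> at
  \<open>v k\<close>, and the later corrections have total norm at most half of \<open>3^(-k)\<close>.\<close>
lemma weakly_bounded_imp_norm_bounded_real:
  fixes A :: "'x::real_normed_vector set"
  assumes wb: "\<And>l :: 'x \<Rightarrow>\<^sub>L real. \<exists>B. \<forall>v\<in>A. \<bar>blinfun_apply l v\<bar> \<le> B"
  shows "\<exists>B. \<forall>v\<in>A. norm v \<le> B"
proof (rule ccontr)
  assume "\<not> ?thesis"
  then have "\<forall>k::nat. \<exists>v\<in>A. 4 ^ k < norm v" by (meson not_le)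
  then obtain v where v: "\<And>k::nat. v k \<in> A" "\<And>k. 4 ^ k < norm (v k)" by metis
  have "\<exists>g :: 'x \<Rightarrow>\<^sub>L real. norm g \<le> 1 \<and> blinfun_apply g (v k) = norm (v k)" for k
  proof -
    obtain l where l: "linear l" "\<And>x. \<bar>l x\<bar> \<le> norm x" "l (v k) = norm (v k)"
      using exists_norming_functional[of "v k"] by blast
    have bl: "bounded_linear l"
      using l by (intro linear_conv_bounded_linear[THEN iffD1] bounded_linear_intro[where K = 1])
        (auto simp: linear_add linear_scale)
    then show ?thesis using l
      by (intro exI[of _ "Blinfun l"] conjI norm_blinfun_bound) (simp_all add: bounded_linear_Blinfun_apply)
  qed
  then obtain g :: "nat \<Rightarrow> 'x \<Rightarrow>\<^sub>L real" where g: "\<And>k. norm (g k) \<le> 1" "\<And>k. blinfun_apply (g k) (v k) = norm (v k)"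
    by metis
  define F where "F = rec_nat 0 (\<lambda>k f. let h = (1/3)^k *\<^sub>R g k in
    if \<bar>blinfun_apply (f - h) (v k)\<bar> \<le> \<bar>blinfun_apply (f + h) (v k)\<bar> then f + h else f - h)"
  have F0: "F 0 = 0" by (simp add: F_def)
  have FS: "F (Suc k) = (let h = (1/3)^k *\<^sub>R g k in
    if \<bar>blinfun_apply (F k - h) (v k)\<bar> \<le> \<bar>blinfun_apply (F k + h) (v k)\<bar> then F k + h else F k - h)" for k
    unfolding F_def by (simp only: nat.rec)
  define D where "D k = F (Suc k) - F k" for k
  have D: "norm (D k) \<le> (1/3)^k" for k
    using mult_left_mono[OF g(1)[of k], of "(1/3)^k"] by (simp add: D_def FS Let_def)
  have big: "(1/3)^k * norm (v k) \<le> \<bar>blinfun_apply (F (Suc k)) (v k)\<bar>" for k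
    by (simp add: FS Let_def blinfun.add_left blinfun.diff_left blinfun.scaleR_left g) linarith
  have geo: "summable (\<lambda>k. (1/3::real)^k)" by (rule summable_geometric) simp
  have sumD: "summable D" using D by (intro summable_comparison_test[OF _ geo]) auto
  define f where "f = suminf D"
  have tail: "norm (f - F (Suc k)) \<le> (1/3)^k / 2" for k
  proof -
    have "F (Suc k) = sum D {..<Suc k}"
      unfolding D_def by (subst sum_lessThan_telescope) (simp add: F0)
    then have "f - F (Suc k) = (\<Sum>j. D (j + Suc k))"
      unfolding f_def using suminf_split_initial_segment[OF sumD, of "Suc k"] by simp
    moreover have "norm (\<Sum>j. D (j + Suc k)) \<le> (\<Sum>j. (1/3)^(j + Suc k))"
      by (intro norm_suminf_le D summable_ignore_initial_segment[OF geo])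
    moreover have "(\<Sum>j. (1/3)^(j + Suc k)) = (1/3)^k / (2::real)"
      using suminf_mult[OF geo, of "(1/3)^Suc k"] suminf_geometric[of "1/3::real"]
      by (simp add: power_add mult.commute)
    ultimately show ?thesis by simp
  qed
  obtain B where B: "\<And>k. \<bar>blinfun_apply f (v k)\<bar> \<le> B" using wb[of f] v(1) by blast
  \<comment> \<open>At \<open>v k\<close> the corrections after step k take away at most half of the
    gain 3^(-k) * norm (v k). What remains is at least (4/3)^k / 2, and this is unbounded.\<close>
  have "(4/3)^k / 2 \<le> B" for k
  proof -
    have "\<bar>blinfun_apply (f - F (Suc k)) (v k)\<bar> \<le> (1/3)^k / 2 * norm (v k)"
      using norm_blinfun[of "f - F (Suc k)" "v k"] mult_right_mono[OF tail[of k], of "norm (v k)"] by simp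
    then have "(1/3)^k / 2 * norm (v k) \<le> \<bar>blinfun_apply f (v k)\<bar>"
      using big[of k] abs_triangle_ineq2[of "blinfun_apply (F (Suc k)) (v k)" "blinfun_apply f (v k)"]
      unfolding blinfun.diff_left abs_minus_commute[of "blinfun_apply f (v k)"] by simp
    moreover have "(1/3)^k / 2 * 4^k \<le> (1/3)^k / 2 * norm (v k)"
      using v(2)[of k] by (intro mult_left_mono) auto
    moreover have "(1/3)^k / 2 * 4^k = (4/3::real)^k / 2" by (simp add: power_divide)
    ultimately show ?thesis using B[of k] by linarith
  qed
  moreover obtain k where "2 * B < (4/3::real)^k" using real_arch_pow[of "4/3"] by auto
  ultimately show False by (metis less_divide_eq_numeral1(1) mult.commute not_le)
qed

text \<open>Every bounded real functional is dominated in absolute value by a functional in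
  \<open>dual sX\<close>, so boundedness under the K-linear dual implies boundedness under the real
  dual.\<close>

lemma weakly_bounded_imp_norm_bounded:
  fixes sX :: "'k::real_or_complex \<Rightarrow> 'x::banach \<Rightarrow> 'x"
  assumes X: "banach_space sX" and wb: "\<And>f. f \<in> dual sX \<Longrightarrow> \<exists>B. \<forall>v\<in>A. norm (blinfun_apply f v) \<le> B"
  shows "\<exists>B. \<forall>v\<in>A. norm v \<le> B"
proof (rule weakly_bounded_imp_norm_bounded_real)
  fix l :: "'x \<Rightarrow>\<^sub>L real"
  have "linear (blinfun_apply l)" by (simp add: blinfun.bounded_linear_right bounded_linear.linear)
  moreover have "\<bar>blinfun_apply l x\<bar> \<le> norm l * norm x" for x using norm_blinfun[of l x] by simp
  ultimately obtain f where "f \<in> dual sX" "\<And>x. \<bar>blinfun_apply l x\<bar> \<le> norm (blinfun_apply f x)"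
    using scalar_extension_functional[OF X, of "blinfun_apply l" "norm l"] by auto
  then show "\<exists>B. \<forall>v\<in>A. \<bar>blinfun_apply l v\<bar> \<le> B" using wb[of f] by (meson order_trans)
qed


section \<open>Weakly summable sequences\<close>

lemma dual_scaleR: "banach_space sX \<Longrightarrow> f \<in> dual sX \<Longrightarrow> r *\<^sub>R f \<in> dual sX"
  by (simp add: dual_iff blinfun.scaleR_left)

lemma dual_apply_scale: "banach_space sX \<Longrightarrow> f \<in> dual sX \<Longrightarrow> blinfun_apply f (sX a x) = a * blinfun_apply f x"
  by (simp add: dual_iff)

lemma weak_norm_leI:
  assumes "\<And>f. f \<in> dual sX \<Longrightarrow> norm f \<le> 1 \<Longrightarrow> strong_norm q I (\<lambda>i. blinfun_apply f (x i)) \<le> t"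
  shows "weak_norm sX q I x \<le> t"
  unfolding weak_norm_def using assms by (intro SUP_least) auto

lemma strong_norm_le_weak_norm:
  "f \<in> dual sX \<Longrightarrow> norm f \<le> 1 \<Longrightarrow> strong_norm q I (\<lambda>i. blinfun_apply f (x i)) \<le> weak_norm sX q I x"
  unfolding weak_norm_def by (intro SUP_upper) auto

lemma strong_norm_functional_le:
  assumes X: "banach_space sX" and q: "1 \<le> q" and f: "f \<in> dual sX"
  shows "strong_norm q I (\<lambda>i. blinfun_apply f (x i)) \<le> ennreal (norm f) * weak_norm sX q I x"
proof (cases "f = 0")
  case True
  then show ?thesis by (simp add: strong_norm_zero[OF q])
next
  case False
  define g where "g = (1 / norm f) *\<^sub>R f"
  have "g \<in> dual sX" "norm g \<le> 1" using dual_scaleR[OF X f] False by (simp_all add: g_def)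
  then have "strong_norm q I (\<lambda>i. blinfun_apply g (x i)) \<le> weak_norm sX q I x"
    by (rule strong_norm_le_weak_norm)
  moreover have "strong_norm q I (\<lambda>i. blinfun_apply f (x i)) \<le>
      ennreal (norm f) * strong_norm q I (\<lambda>i. blinfun_apply g (x i))"
    using False by (intro strong_norm_scale_le q) (auto simp: g_def blinfun.scaleR_left)
  ultimately show ?thesis by (meson mult_left_mono order_trans zero_le)
qed

lemma norm_le_weak_norm:
  assumes X: "banach_space sX" and q: "1 \<le> q" and i: "i \<in> I"
  shows "ennreal (norm (x i)) \<le> weak_norm sX q I x"
proof -
  obtain f where f: "f \<in> dual sX" "norm f \<le> 1" "norm (x i) \<le> norm (blinfun_apply f (x i))"
    using exists_norming_dual[OF X, of "x i"] by blast
  then have "ennreal (norm (x i)) \<le> ennreal (norm (blinfun_apply f (x i)))" by (simp add: ennreal_leI)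
  also have "\<dots> \<le> weak_norm sX q I x"
    using norm_le_strong_norm[OF q i, of "\<lambda>i. blinfun_apply f (x i)"] strong_norm_le_weak_norm[OF f(1,2)]
    by (rule order_trans)
  finally show ?thesis .
qed

lemma weak_norm_mono:
  "1 \<le> q \<Longrightarrow> I \<subseteq> J \<Longrightarrow> weak_norm sX q I x \<le> weak_norm sX q J x"
  by (intro weak_norm_leI order_trans[OF strong_norm_mono strong_norm_le_weak_norm]) auto

lemma weak_norm_cong:
  "(\<And>i. i \<in> I \<Longrightarrow> x i = y i) \<Longrightarrow> 1 \<le> q \<Longrightarrow> weak_norm sX q I x = weak_norm sX q I y"
  unfolding weak_norm_def by (intro SUP_cong strong_norm_cong_norm) auto

lemma weak_norm_Un_le:
  assumes q: "1 \<le> q"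
  shows "weak_norm sX q (I \<union> J) x \<le> weak_norm sX q I x + weak_norm sX q J x"
proof (rule weak_norm_leI)
  fix f assume "f \<in> dual sX" "norm f \<le> 1"
  then show "strong_norm q (I \<union> J) (\<lambda>i. blinfun_apply f (x i)) \<le> weak_norm sX q I x + weak_norm sX q J x"
    by (intro order_trans[OF strong_norm_Un_le[OF q] add_mono] strong_norm_le_weak_norm)
qed

lemma weak_norm_UN_le:
  assumes q: "1 \<le> q" and K: "finite K"
  shows "weak_norm sX q (\<Union>k\<in>K. I k) x \<le> (\<Sum>k\<in>K. weak_norm sX q (I k) x)"
proof (rule weak_norm_leI)
  fix f assume "f \<in> dual sX" "norm f \<le> 1"
  then show "strong_norm q (\<Union>k\<in>K. I k) (\<lambda>i. blinfun_apply f (x i)) \<le> (\<Sum>k\<in>K. weak_norm sX q (I k) x)"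
    by (intro order_trans[OF strong_norm_UN_le[OF q K] sum_mono] strong_norm_le_weak_norm)
qed

lemma weak_norm_reindex:
  "1 \<le> q \<Longrightarrow> inj_on g I \<Longrightarrow> weak_norm sX q (g ` I) x = weak_norm sX q I (\<lambda>i. x (g i))"
  unfolding weak_norm_def by (simp add: strong_norm_reindex)

lemma weak_norm_scaleR_le:
  assumes q: "1 \<le> q" and c: "0 \<le> c"
  shows "weak_norm sX q I (\<lambda>i. c *\<^sub>R x i) \<le> ennreal c * weak_norm sX q I x"
proof (rule weak_norm_leI)
  fix f assume f: "f \<in> dual sX" "norm f \<le> 1"
  have "strong_norm q I (\<lambda>i. blinfun_apply f (c *\<^sub>R x i)) \<le> ennreal c * strong_norm q I (\<lambda>i. blinfun_apply f (x i))"
    using c by (intro strong_norm_scale_le q) (auto simp: blinfun.scaleR_right)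
  also have "\<dots> \<le> ennreal c * weak_norm sX q I x"
    by (intro mult_left_mono strong_norm_le_weak_norm[OF f]) simp
  finally show "strong_norm q I (\<lambda>i. blinfun_apply f (c *\<^sub>R x i)) \<le> ennreal c * weak_norm sX q I x" .
qed

lemma weak_norm_zero:
  assumes "1 \<le> q" "\<And>i. i \<in> I \<Longrightarrow> x i = 0"
  shows "weak_norm sX q I x = 0"
  using weak_norm_leI[of sX q I x 0] assms by (simp add: strong_norm_zero)

lemma weak_norm_truncate:
  assumes q: "1 \<le> q"
  shows "weak_norm sX q I (\<lambda>i. if i \<in> J then x i else 0) = weak_norm sX q (I \<inter> J) x"
proof (rule antisym)
  let ?y = "\<lambda>i. if i \<in> J then x i else 0"
  have "weak_norm sX q I ?y \<le> weak_norm sX q (I \<inter> J) ?y + weak_norm sX q (I - J) ?y"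
    using weak_norm_Un_le[OF q, of sX "I \<inter> J" "I - J" ?y] by (simp add: Int_Diff_Un)
  also have "weak_norm sX q (I - J) ?y = 0" using q by (intro weak_norm_zero) auto
  also have "weak_norm sX q (I \<inter> J) ?y = weak_norm sX q (I \<inter> J) x" using q by (intro weak_norm_cong) auto
  finally show "weak_norm sX q I ?y \<le> weak_norm sX q (I \<inter> J) x" by simp
  have "weak_norm sX q (I \<inter> J) x = weak_norm sX q (I \<inter> J) ?y" using q by (intro weak_norm_cong) auto
  also have "\<dots> \<le> weak_norm sX q I ?y" using q by (intro weak_norm_mono) auto
  finally show "weak_norm sX q (I \<inter> J) x \<le> weak_norm sX q I ?y" .
qed

lemma weak_norm_finite:
  assumes q: "1 \<le> q" and I: "finite I"
  shows "weak_norm sX q I x < top"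
proof -
  have "weak_norm sX q I x \<le> strong_norm q I x"
    using q by (intro weak_norm_leI strong_norm_mono norm_dual_apply_le) auto
  also have "\<dots> < top" using strong_norm_finite[OF q I, of x] by simp
  finally show ?thesis .
qed

text \<open>The bounds \<open>a\<close> and \<open>b\<close> do not depend on the functional, so
  q-th powers may be added for each functional before the supremum is taken. The triangle inequality
  of d_p rests on this.\<close>

lemma weak_norm_Un_powr:
  assumes "1 \<le> q" "e = enn2real (inverse q)" "0 < a" "0 < b"
    and "weak_norm sX q I x \<le> ennreal (a powr e)" "weak_norm sX q J x \<le> ennreal (b powr e)"
  shows "weak_norm sX q (I \<union> J) x \<le> ennreal ((a + b) powr e)"
proof (rule weak_norm_leI)
  fix f assume f: "f \<in> dual sX" "norm f \<le> 1"
  show "strong_norm q (I \<union> J) (\<lambda>i. blinfun_apply f (x i)) \<le> ennreal ((a + b) powr e)"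
    by (rule strong_norm_Un_powr[OF assms(1-4)])
      (rule order_trans[OF strong_norm_le_weak_norm[OF f] assms(5)]
        order_trans[OF strong_norm_le_weak_norm[OF f] assms(6)])+
qed

lemma weak_norm_le_finite_subsets:
  assumes q: "1 \<le> q" and t: "0 \<le> t"
    and le: "\<And>F. finite F \<Longrightarrow> F \<subseteq> I \<Longrightarrow> weak_norm sX q F x \<le> ennreal t"
  shows "weak_norm sX q I x \<le> ennreal t"
proof (rule weak_norm_leI)
  fix f assume f: "f \<in> dual sX" "norm f \<le> 1"
  show "strong_norm q I (\<lambda>i. blinfun_apply f (x i)) \<le> ennreal t"
    by (subst strong_norm_le_iff_finite_subsets[OF q t])
      (use strong_norm_le_weak_norm[OF f] le in \<open>blast intro: order_trans\<close>)
qed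

text \<open>Finiteness for each functional becomes a uniform bound. Hoelder's inequality makes the
  set \<open>A\<close> of sums of a_i x_i, with \<open>a\<close> in the unit ball of l_p, bounded
  under each functional; uniform boundedness makes it norm bounded, and the converse of Hoelder's
  inequality reads off the weak norm. The exponent is written \<open>conjugate p\<close> because
  this duality uses \<open>p\<close>.\<close>

lemma weakly_summable_iff:
  fixes sX :: "'k::real_or_complex \<Rightarrow> 'x::banach \<Rightarrow> 'x"
  assumes X: "banach_space sX" and p: "1 \<le> p"
  shows "x \<in> weakly_summable sX (conjugate p) \<longleftrightarrow> weak_norm sX (conjugate p) UNIV x < top"
proof
  let ?q = "conjugate p"
  note q = conjugate_ge_1[OF p]
  interpret X: vector_space sX by (rule banach_space_vector_space[OF X])
  assume x: "x \<in> weakly_summable sX ?q"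
  define A where "A = {\<Sum>i<n. sX (a i) (x i) |n a. strong_norm p {..<n} a \<le> 1}"
  have apply_sum: "blinfun_apply f (\<Sum>i<n. sX (a i) (x i)) = (\<Sum>i<n. a i * blinfun_apply f (x i))"
    if "f \<in> dual sX" for f a and n :: nat
    by (simp add: blinfun.sum_right dual_apply_scale[OF X that])
  have "\<exists>B. \<forall>v\<in>A. norm (blinfun_apply f v) \<le> B" if f: "f \<in> dual sX" for f
  proof -
    have "strong_norm ?q UNIV (\<lambda>i. blinfun_apply f (x i)) < top"
      using x f by (auto simp: weakly_summable_def)
    then obtain B where B: "0 \<le> B" "strong_norm ?q UNIV (\<lambda>i. blinfun_apply f (x i)) = ennreal B"
      by (cases "strong_norm ?q UNIV (\<lambda>i. blinfun_apply f (x i))") auto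
    have "norm (\<Sum>i<n. a i * blinfun_apply f (x i)) \<le> B" if a: "strong_norm p {..<n} a \<le> 1" for n a
    proof -
      have "strong_norm ?q {..<n} (\<lambda>i. blinfun_apply f (x i)) \<le> ennreal B"
        unfolding B(2)[symmetric] by (intro strong_norm_mono q) auto
      then have "(\<Sum>i<n. norm (a i) * norm (blinfun_apply f (x i))) \<le> 1 * B"
        using a B(1) by (intro holder_sum[OF p]) auto
      moreover have "norm (\<Sum>i<n. a i * blinfun_apply f (x i)) \<le> (\<Sum>i<n. norm (a i) * norm (blinfun_apply f (x i)))"
        by (intro order_trans[OF norm_sum]) (simp add: norm_mult)
      ultimately show ?thesis by simp
    qed
    then show ?thesis by (intro exI[of _ B]) (auto simp: A_def apply_sum[OF f])
  qed
  then obtain B where B: "\<And>v. v \<in> A \<Longrightarrow> norm v \<le> B"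
    using weakly_bounded_imp_norm_bounded[OF X] by metis
  have "weak_norm sX ?q UNIV x \<le> ennreal (max B 0)"
  proof (rule weak_norm_leI)
    fix f assume f: "f \<in> dual sX" "norm f \<le> 1"
    have "strong_norm ?q {..<n} (\<lambda>i. blinfun_apply f (x i)) \<le> ennreal (max B 0)" for n
    proof (rule strong_norm_dual_le[OF p])
      fix a :: "nat \<Rightarrow> 'k" assume "strong_norm p {..<n} a \<le> 1"
      then have "norm (\<Sum>i<n. sX (a i) (x i)) \<le> B" by (intro B) (auto simp: A_def)
      then show "norm (\<Sum>i<n. a i * blinfun_apply f (x i)) \<le> max B 0"
        using norm_dual_apply_le[OF f(2)] by (simp flip: apply_sum[OF f(1)]) (meson order_trans max.cobounded1)
    qed auto
    note le = this
    have "strong_norm ?q F (\<lambda>i. blinfun_apply f (x i)) \<le> ennreal (max B 0)" if F: "finite F" for F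
    proof -
      obtain n where "F \<subseteq> {..<n}" using F finite_nat_iff_bounded by blast
      then have "strong_norm ?q F (\<lambda>i. blinfun_apply f (x i)) \<le> strong_norm ?q {..<n} (\<lambda>i. blinfun_apply f (x i))"
        by (intro strong_norm_mono q) auto
      then show ?thesis using le by (rule order_trans)
    qed
    then show "strong_norm ?q UNIV (\<lambda>i. blinfun_apply f (x i)) \<le> ennreal (max B 0)"
      by (subst strong_norm_le_iff_finite_subsets[OF q]) auto
  qed
  then show "weak_norm sX ?q UNIV x < top" by (rule le_less_trans) simp
next
  assume x: "weak_norm sX (conjugate p) UNIV x < top"
  have "strong_norm (conjugate p) UNIV (\<lambda>i. blinfun_apply f (x i)) < top" if f: "f \<in> dual sX" for f
    using strong_norm_functional_le[OF X conjugate_ge_1[OF p] f, of UNIV x] x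
    by (metis ennreal_mult_less_top ennreal_less_top le_less_trans)
  then show "x \<in> weakly_summable sX (conjugate p)" by (auto simp: weakly_summable_def)
qed

text \<open>Subtracting the truncation at \<open>N\<close> leaves the sequence that is zero before
  \<open>N\<close>, whose weak norm is that of the tail. Convergence of tails is what the tail
  estimates deliver.\<close>

lemma unconditionally_summable_iff:
  fixes sX :: "'k::real_or_complex \<Rightarrow> 'x::banach \<Rightarrow> 'x"
  assumes X: "banach_space sX" and p: "1 \<le> p"
  shows "x \<in> unconditionally_summable sX (conjugate p) \<longleftrightarrow>
    weak_norm sX (conjugate p) UNIV x < top \<and> (\<lambda>N. weak_norm sX (conjugate p) {N..} x) \<longlonglongrightarrow> 0"
proof -
  have "(\<lambda>i. x i - (if i < N then x i else 0)) = (\<lambda>i. if i \<in> {N..} then x i else 0)" for N :: nat by auto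
  then show ?thesis
    using weakly_summable_iff[OF X p, of x] weak_norm_truncate[OF conjugate_ge_1[OF p], of sX UNIV]
    by (simp add: unconditionally_summable_def del: atLeast_iff)
qed


section \<open>Operators on the completion of a seminormed space\<close>

text \<open>Abstracts the tensor space with d_p. The tensor operations are total and pointwise, so
  their identities hold on the whole type, whereas subadditivity and the scaling bound are required
  only on \<open>E\<close>, where representations exist.\<close>

locale seminormed_space =
  fixes sE :: "'k::real_or_complex \<Rightarrow> 'v::ab_group_add \<Rightarrow> 'v" and E :: "'v set" and \<nu> :: "'v \<Rightarrow> real"
  assumes zero_in: "0 \<in> E"
    and add_in: "u \<in> E \<Longrightarrow> v \<in> E \<Longrightarrow> u + v \<in> E"
    and scale_in: "u \<in> E \<Longrightarrow> sE a u \<in> E"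
    and scale_minus_one: "sE (- 1) u = - u"
    and scale_diff: "sE a (u - v) = sE a u - sE a v"
    and norm_zero: "\<nu> 0 = 0"
    and norm_nonneg: "0 \<le> \<nu> u"
    and norm_add: "u \<in> E \<Longrightarrow> v \<in> E \<Longrightarrow> \<nu> (u + v) \<le> \<nu> u + \<nu> v"
    and norm_scale: "u \<in> E \<Longrightarrow> \<nu> (sE a u) \<le> norm a * \<nu> u"
begin

lemma minus_in: "u \<in> E \<Longrightarrow> - u \<in> E"
  using scale_in[of u "- 1"] by (simp add: scale_minus_one)

lemma diff_in: "u \<in> E \<Longrightarrow> v \<in> E \<Longrightarrow> u - v \<in> E"
  using add_in[of u "- v"] minus_in[of v] by simp

lemma norm_minus_commute: "u \<in> E \<Longrightarrow> v \<in> E \<Longrightarrow> \<nu> (u - v) = \<nu> (v - u)"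
  using norm_scale[of "u - v" "- 1"] norm_scale[of "v - u" "- 1"] diff_in
  by (simp add: scale_minus_one antisym)

lemma norm_diff_triangle:
  "u \<in> E \<Longrightarrow> v \<in> E \<Longrightarrow> w \<in> E \<Longrightarrow> \<nu> (u - w) \<le> \<nu> (u - v) + \<nu> (v - w)"
  using norm_add[of "u - v" "v - w"] diff_in by simp

lemma norm_diff_add:
  "u \<in> E \<Longrightarrow> v \<in> E \<Longrightarrow> u' \<in> E \<Longrightarrow> v' \<in> E \<Longrightarrow> \<nu> (u + v - (u' + v')) \<le> \<nu> (u - u') + \<nu> (v - v')"
  using norm_add[of "u - u'" "v - v'"] diff_in by (simp add: algebra_simps)

lemma norm_diff_le: "u \<in> E \<Longrightarrow> v \<in> E \<Longrightarrow> \<bar>\<nu> u - \<nu> v\<bar> \<le> \<nu> (u - v)"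
  using norm_add[of "u - v" v] norm_add[of "v - u" u] diff_in norm_minus_commute[of u v] by fastforce

lemma cauchy_seqs_in: "u \<in> cauchy_seqs E \<nu> \<Longrightarrow> u n \<in> E"
  by (auto simp: cauchy_seqs_def)

lemma cauchy_seqsD: "u \<in> cauchy_seqs E \<nu> \<Longrightarrow> 0 < e \<Longrightarrow> \<exists>N. \<forall>m\<ge>N. \<forall>n\<ge>N. \<nu> (u m - u n) < e"
  by (auto simp: cauchy_seqs_def)

lemma cauchy_seqs_const: "u \<in> E \<Longrightarrow> (\<lambda>_. u) \<in> cauchy_seqs E \<nu>"
  by (auto simp: cauchy_seqs_def norm_zero)

lemma cauchy_seqs_add:
  assumes u: "u \<in> cauchy_seqs E \<nu>" and v: "v \<in> cauchy_seqs E \<nu>"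
  shows "(\<lambda>n. u n + v n) \<in> cauchy_seqs E \<nu>"
proof -
  have "\<exists>N. \<forall>m\<ge>N. \<forall>n\<ge>N. \<nu> (u m + v m - (u n + v n)) < e" if "0 < e" for e :: real
  proof -
    obtain M N where M: "\<And>m n. m \<ge> M \<Longrightarrow> n \<ge> M \<Longrightarrow> \<nu> (u m - u n) < e / 2"
      and N: "\<And>m n. m \<ge> N \<Longrightarrow> n \<ge> N \<Longrightarrow> \<nu> (v m - v n) < e / 2"
      using cauchy_seqsD[OF u half_gt_zero] cauchy_seqsD[OF v half_gt_zero] \<open>0 < e\<close> by metis
    have "\<nu> (u m + v m - (u n + v n)) < e" if "m \<ge> max M N" "n \<ge> max M N" for m n
      using M[of m n] N[of m n] that
        norm_diff_add[OF cauchy_seqs_in[OF u, of m] cauchy_seqs_in[OF v, of m]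
          cauchy_seqs_in[OF u, of n] cauchy_seqs_in[OF v, of n]] by simp
    then show ?thesis by blast
  qed
  then show ?thesis using add_in cauchy_seqs_in[OF u] cauchy_seqs_in[OF v] by (auto simp: cauchy_seqs_def)
qed

lemma cauchy_seqs_scale:
  assumes u: "u \<in> cauchy_seqs E \<nu>"
  shows "(\<lambda>n. sE a (u n)) \<in> cauchy_seqs E \<nu>"
proof -
  have "\<exists>N. \<forall>m\<ge>N. \<forall>n\<ge>N. \<nu> (sE a (u m) - sE a (u n)) < e" if e: "0 < e" for e :: real
  proof -
    obtain N where N: "\<And>m n. m \<ge> N \<Longrightarrow> n \<ge> N \<Longrightarrow> \<nu> (u m - u n) < e / (norm a + 1)"
      using cauchy_seqsD[OF u, of "e / (norm a + 1)"] e norm_ge_zero[of a] by (auto simp: add_nonneg_pos)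
    have "\<nu> (sE a (u m) - sE a (u n)) < e" if "m \<ge> N" "n \<ge> N" for m n
    proof -
      have "\<nu> (sE a (u m) - sE a (u n)) \<le> norm a * \<nu> (u m - u n)"
        using norm_scale[OF diff_in[OF cauchy_seqs_in[OF u, of m] cauchy_seqs_in[OF u, of n]], of a]
        by (simp add: scale_diff)
      also have "\<dots> \<le> (norm a + 1) * \<nu> (u m - u n)" by (intro mult_right_mono norm_nonneg) simp
      also have "\<dots> < e" using N[OF that] norm_ge_zero[of a] by (simp add: less_divide_eq mult.commute add_nonneg_pos)
      finally show ?thesis .
    qed
    then show ?thesis by blast
  qed
  then show ?thesis using scale_in cauchy_seqs_in[OF u] by (auto simp: cauchy_seqs_def)
qed

lemma cauchy_class_eqI:
  assumes u: "u \<in> cauchy_seqs E \<nu>" and v: "v \<in> cauchy_seqs E \<nu>" and lim: "(\<lambda>n. \<nu> (u n - v n)) \<longlonglongrightarrow> 0"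
  shows "cauchy_class E \<nu> u = cauchy_class E \<nu> v"
proof -
  have "(\<lambda>n. \<nu> (b n - w n)) \<longlonglongrightarrow> 0"
    if a: "a \<in> cauchy_seqs E \<nu>" and b: "b \<in> cauchy_seqs E \<nu>" and w: "w \<in> cauchy_seqs E \<nu>"
      and ab: "(\<lambda>n. \<nu> (b n - a n)) \<longlonglongrightarrow> 0" and aw: "(\<lambda>n. \<nu> (a n - w n)) \<longlonglongrightarrow> 0" for a b w
  proof (rule tendsto_sandwich[OF _ _ tendsto_const])
    show "(\<lambda>n. \<nu> (b n - a n) + \<nu> (a n - w n)) \<longlonglongrightarrow> 0" using tendsto_add[OF ab aw] by simp
  qed (use norm_nonneg norm_diff_triangle cauchy_seqs_in a b w in auto)
  moreover have "(\<lambda>n. \<nu> (v n - u n)) \<longlonglongrightarrow> 0"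
    using lim norm_minus_commute cauchy_seqs_in[OF u] cauchy_seqs_in[OF v] by simp
  ultimately show ?thesis using u v lim by (auto simp: cauchy_class_def)
qed

text \<open>A class contains the sequence that defines it, so the choice in
  \<open>representative\<close> succeeds. The chosen sequence differs from \<open>w\<close> by a
  null sequence, and the operations on classes do not see such a difference.\<close>

lemma representative_class:
  assumes "w \<in> cauchy_seqs E \<nu>"
  shows "representative (cauchy_class E \<nu> w) \<in> cauchy_seqs E \<nu>"
    and "(\<lambda>n. \<nu> (w n - representative (cauchy_class E \<nu> w) n)) \<longlonglongrightarrow> 0"
proof -
  have "w \<in> cauchy_class E \<nu> w" using assms by (simp add: cauchy_class_def norm_zero)
  then have "representative (cauchy_class E \<nu> w) \<in> cauchy_class E \<nu> w"
    unfolding representative_def by (rule someI[where P = "\<lambda>u. u \<in> cauchy_class E \<nu> w"])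
  then show "representative (cauchy_class E \<nu> w) \<in> cauchy_seqs E \<nu>"
    and "(\<lambda>n. \<nu> (w n - representative (cauchy_class E \<nu> w) n)) \<longlonglongrightarrow> 0"
    by (simp_all add: cauchy_class_def)
qed

lemma completion_add_class:
  assumes u: "u \<in> cauchy_seqs E \<nu>" and v: "v \<in> cauchy_seqs E \<nu>"
  shows "completion_add E \<nu> (cauchy_class E \<nu> u) (cauchy_class E \<nu> v) = cauchy_class E \<nu> (\<lambda>n. u n + v n)"
proof -
  note ru = representative_class[OF u] and rv = representative_class[OF v]
  show ?thesis
    unfolding completion_add_def
  proof (rule sym, intro cauchy_class_eqI cauchy_seqs_add u v ru(1) rv(1))
    show "(\<lambda>n. \<nu> (u n + v n - (representative (cauchy_class E \<nu> u) n + representative (cauchy_class E \<nu> v) n))) \<longlonglongrightarrow> 0"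
    proof (rule tendsto_sandwich[OF _ _ tendsto_const])
      show "(\<lambda>n. \<nu> (u n - representative (cauchy_class E \<nu> u) n) +
          \<nu> (v n - representative (cauchy_class E \<nu> v) n)) \<longlonglongrightarrow> 0"
        using tendsto_add[OF ru(2) rv(2)] by simp
    qed (use norm_nonneg norm_diff_add cauchy_seqs_in[OF u] cauchy_seqs_in[OF v]
        cauchy_seqs_in[OF ru(1)] cauchy_seqs_in[OF rv(1)] in auto)
  qed
qed

lemma completion_scale_class:
  assumes u: "u \<in> cauchy_seqs E \<nu>"
  shows "completion_scale sE E \<nu> a (cauchy_class E \<nu> u) = cauchy_class E \<nu> (\<lambda>n. sE a (u n))"
proof -
  note ru = representative_class[OF u]
  show ?thesis
    unfolding completion_scale_def
  proof (rule sym, intro cauchy_class_eqI cauchy_seqs_scale u ru(1))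
    show "(\<lambda>n. \<nu> (sE a (u n) - sE a (representative (cauchy_class E \<nu> u) n))) \<longlonglongrightarrow> 0"
    proof (rule tendsto_sandwich[OF _ _ tendsto_const])
      show "(\<lambda>n. norm a * \<nu> (u n - representative (cauchy_class E \<nu> u) n)) \<longlonglongrightarrow> 0"
        using tendsto_mult_left[OF ru(2)] by simp
    qed (use norm_nonneg norm_scale[of "u _ - representative _ _" a] diff_in
        cauchy_seqs_in[OF u] cauchy_seqs_in[OF ru(1)] in \<open>auto simp: scale_diff\<close>)
  qed
qed

lemma completion_norm_class:
  assumes u: "u \<in> cauchy_seqs E \<nu>"
  shows "(\<lambda>n. \<nu> (u n)) \<longlonglongrightarrow> completion_norm \<nu> (cauchy_class E \<nu> u)"
proof -
  define r where "r = representative (cauchy_class E \<nu> u)"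
  note r = representative_class[OF u, folded r_def]
  have "Cauchy (\<lambda>n. \<nu> (r n))"
  proof (rule CauchyI)
    fix e :: real assume "0 < e"
    then obtain N where "\<And>m n. m \<ge> N \<Longrightarrow> n \<ge> N \<Longrightarrow> \<nu> (r m - r n) < e"
      using cauchy_seqsD[OF r(1)] by metis
    then show "\<exists>M. \<forall>m\<ge>M. \<forall>n\<ge>M. norm (\<nu> (r m) - \<nu> (r n)) < e"
      using norm_diff_le cauchy_seqs_in[OF r(1)] by (metis le_less_trans real_norm_def)
  qed
  then have 1: "(\<lambda>n. \<nu> (r n)) \<longlonglongrightarrow> completion_norm \<nu> (cauchy_class E \<nu> u)"
    unfolding completion_norm_def r_def[symmetric] by (simp add: Cauchy_convergent_iff convergent_LIMSEQ_iff)
  have "(\<lambda>n. \<nu> (u n) - \<nu> (r n)) \<longlonglongrightarrow> 0"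
    by (rule tendsto_rabs_zero_cancel, rule tendsto_sandwich[OF _ _ tendsto_const r(2)])
      (use norm_diff_le cauchy_seqs_in[OF u] cauchy_seqs_in[OF r(1)] in auto)
  from tendsto_add[OF this 1] show ?thesis by simp
qed

text \<open>What an operator on the completion says about \<open>E\<close> itself: constant
  sequences represent the elements of \<open>E\<close>, and their completion norm is their original
  seminorm.\<close>

lemma completion_operator_embed:
  assumes U: "U \<in> completion_operators sE E \<nu> sY"
  shows "u \<in> E \<Longrightarrow> v \<in> E \<Longrightarrow>
      U (completion_embed E \<nu> (u + v)) = U (completion_embed E \<nu> u) + U (completion_embed E \<nu> v)"
    and "\<exists>C>0. \<forall>u\<in>E. norm (U (completion_embed E \<nu> u)) \<le> C * \<nu> u"
proof -
  have emb: "completion_embed E \<nu> u \<in> completion E \<nu>" if "u \<in> E" for u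
    using cauchy_seqs_const[OF that] by (auto simp: completion_def completion_embed_def)
  show "U (completion_embed E \<nu> (u + v)) = U (completion_embed E \<nu> u) + U (completion_embed E \<nu> v)"
    if "u \<in> E" "v \<in> E"
  proof -
    have "completion_embed E \<nu> (u + v) = completion_add E \<nu> (completion_embed E \<nu> u) (completion_embed E \<nu> v)"
      unfolding completion_embed_def using completion_add_class[OF cauchy_seqs_const cauchy_seqs_const, OF that] by simp
    then show ?thesis using U emb that by (simp add: completion_operators_def)
  qed
  obtain C where C: "\<And>A. A \<in> completion E \<nu> \<Longrightarrow> norm (U A) \<le> C * completion_norm \<nu> A"
    using U unfolding completion_operators_def by blast
  \<comment> \<open>The bound \<open>C\<close> in the definition of an operator may be 0 or
    negative; |C| + 1 is a positive one.\<close>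
  have "norm (U (completion_embed E \<nu> u)) \<le> (\<bar>C\<bar> + 1) * \<nu> u" if "u \<in> E" for u
  proof -
    have "completion_norm \<nu> (completion_embed E \<nu> u) = \<nu> u"
      unfolding completion_embed_def using completion_norm_class[OF cauchy_seqs_const[OF that]]
      by (simp add: LIMSEQ_const_iff)
    then have "norm (U (completion_embed E \<nu> u)) \<le> C * \<nu> u" using C[OF emb[OF that]] by simp
    also have "\<dots> \<le> (\<bar>C\<bar> + 1) * \<nu> u" by (intro mult_right_mono norm_nonneg) simp
    finally show ?thesis .
  qed
  then show "\<exists>C>0. \<forall>u\<in>E. norm (U (completion_embed E \<nu> u)) \<le> C * \<nu> u"
    by (intro exI[of _ "\<bar>C\<bar> + 1"]) auto
qed

text \<open>Extension by continuity: \<open>L\<close> sends Cauchy sequences of \<open>E\<close> to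
  Cauchy sequences of the complete space Y and null sequences to null sequences. Hence the limit
  along the chosen representative is the limit along every sequence in the class.\<close>

lemma completion_operator_extend:
  fixes sY :: "'k \<Rightarrow> 'y::banach \<Rightarrow> 'y"
  assumes Y: "banach_space sY"
    and L_add: "\<And>u v. u \<in> E \<Longrightarrow> v \<in> E \<Longrightarrow> L (u + v) = L u + L v"
    and L_scale: "\<And>a u. u \<in> E \<Longrightarrow> L (sE a u) = sY a (L u)"
    and L_le: "\<And>u. u \<in> E \<Longrightarrow> norm (L u) \<le> C * \<nu> u" and C: "0 < C"
  shows "\<exists>U\<in>completion_operators sE E \<nu> sY. \<forall>u\<in>E. U (completion_embed E \<nu> u) = L u"
proof -
  interpret Y: vector_space sY using Y by (simp add: banach_space_def)
  have L_diff: "norm (L u - L v) \<le> C * \<nu> (u - v)" if "u \<in> E" "v \<in> E" for u v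
    using L_add[of "u - v" v] L_le[of "u - v"] diff_in[OF that] that by simp
  define U where "U A = lim (\<lambda>n. L (representative A n))" for A
  have U: "(\<lambda>n. L (w n)) \<longlonglongrightarrow> U (cauchy_class E \<nu> w)" if w: "w \<in> cauchy_seqs E \<nu>" for w
  proof -
    define r where "r = representative (cauchy_class E \<nu> w)"
    note r = representative_class[OF w, folded r_def]
    have "Cauchy (\<lambda>n. L (r n))"
    proof (rule CauchyI)
      fix e :: real assume "0 < e"
      then obtain N where N: "\<And>m n. m \<ge> N \<Longrightarrow> n \<ge> N \<Longrightarrow> \<nu> (r m - r n) < e / C"
        using cauchy_seqsD[OF r(1), of "e / C"] C by auto
      have "norm (L (r m) - L (r n)) < e" if "m \<ge> N" "n \<ge> N" for m n
        using L_diff[OF cauchy_seqs_in[OF r(1)] cauchy_seqs_in[OF r(1)], of m n] N[OF that] C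
        by (simp add: less_divide_eq mult.commute)
      then show "\<exists>M. \<forall>m\<ge>M. \<forall>n\<ge>M. norm (L (r m) - L (r n)) < e" by blast
    qed
    then have 1: "(\<lambda>n. L (r n)) \<longlonglongrightarrow> U (cauchy_class E \<nu> w)"
      unfolding U_def r_def[symmetric] by (simp add: Cauchy_convergent_iff convergent_LIMSEQ_iff)
    have "(\<lambda>n. L (w n) - L (r n)) \<longlonglongrightarrow> 0"
    proof (rule tendsto_norm_zero_cancel, rule tendsto_sandwich[OF _ _ tendsto_const])
      show "(\<lambda>n. C * \<nu> (w n - r n)) \<longlonglongrightarrow> 0" using tendsto_mult_left[OF r(2)] by simp
    qed (use L_diff cauchy_seqs_in[OF w] cauchy_seqs_in[OF r(1)] in auto)
    from tendsto_add[OF this 1] show ?thesis by simp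
  qed
  have "U \<in> completion_operators sE E \<nu> sY"
    unfolding completion_operators_def completion_def
  proof (intro CollectI conjI ballI allI exI)
    fix A B assume "A \<in> cauchy_class E \<nu> ` cauchy_seqs E \<nu>" "B \<in> cauchy_class E \<nu> ` cauchy_seqs E \<nu>"
    then obtain u v where uv: "u \<in> cauchy_seqs E \<nu>" "v \<in> cauchy_seqs E \<nu>"
      and AB: "A = cauchy_class E \<nu> u" "B = cauchy_class E \<nu> v" by auto
    have "(\<lambda>n. L (u n + v n)) \<longlonglongrightarrow> U A + U B"
      using tendsto_add[OF U[OF uv(1)] U[OF uv(2)]] L_add cauchy_seqs_in[OF uv(1)] cauchy_seqs_in[OF uv(2)]
      by (simp add: AB)
    then show "U (completion_add E \<nu> A B) = U A + U B"
      using U[OF cauchy_seqs_add[OF uv]] completion_add_class[OF uv] AB LIMSEQ_unique by metis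
  next
    fix a A assume "A \<in> cauchy_class E \<nu> ` cauchy_seqs E \<nu>"
    then obtain u where u: "u \<in> cauchy_seqs E \<nu>" and A: "A = cauchy_class E \<nu> u" by auto
    \<comment> \<open>Multiplication by a scalar of K has to pass through the limit, hence its
      continuity.\<close>
    have "bounded_linear (sY a)"
    proof (rule bounded_linear_intro)
      show "sY a (x + y) = sY a x + sY a y" for x y by (rule Y.scale_right_distrib)
      show "sY a (r *\<^sub>R x) = r *\<^sub>R sY a x" for r x
        using Y Y.scale_left_commute[of a "of_real r" x] by (metis banach_space_def)
      show "norm (sY a x) \<le> norm x * norm a" for x
        using Y by (simp add: banach_space_def mult.commute)
    qed
    from bounded_linear.tendsto[OF this U[OF u]] have "(\<lambda>n. L (sE a (u n))) \<longlonglongrightarrow> sY a (U A)"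
      using L_scale cauchy_seqs_in[OF u] by (simp add: A)
    then show "U (completion_scale sE E \<nu> a A) = sY a (U A)"
      using U[OF cauchy_seqs_scale[OF u]] completion_scale_class[OF u] A LIMSEQ_unique by metis
  next
    fix A assume "A \<in> cauchy_class E \<nu> ` cauchy_seqs E \<nu>"
    then obtain u where u: "u \<in> cauchy_seqs E \<nu>" and A: "A = cauchy_class E \<nu> u" by auto
    show "norm (U A) \<le> C * completion_norm \<nu> A"
      unfolding A
      by (rule LIMSEQ_le[OF tendsto_norm[OF U[OF u]] tendsto_mult_left[OF completion_norm_class[OF u]]])
        (use L_le cauchy_seqs_in[OF u] in auto)
  qed
  moreover have "U (completion_embed E \<nu> u) = L u" if "u \<in> E" for u
    using U[OF cauchy_seqs_const[OF that]] by (simp add: completion_embed_def LIMSEQ_const_iff)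
  ultimately show ?thesis by blast
qed

end


section \<open>The Chevet--Saphar norm\<close>

lemma tensor_sum_apply: "(\<Sum>i<n. f i) B = (\<Sum>i<n. f i B)" for f :: "nat \<Rightarrow> 'b \<Rightarrow> 'k::comm_monoid_add" and n :: nat
  by (induction n) (simp_all add: zero_fun_def)

lemma sum_lessThan_add: "(\<Sum>i<n + m. f i) = (\<Sum>i<n. f i) + (\<Sum>j<m. f (n + j))" for f :: "nat \<Rightarrow> 'b::comm_monoid_add" and m n :: nat
  by (induction m) (simp_all add: add.assoc)

lemma lessThan_add: "{..<n + m} = {..<n} \<union> (+) n ` {..<m}" for n m :: nat
proof (intro set_eqI)
  show "i \<in> {..<n + m} \<longleftrightarrow> i \<in> {..<n} \<union> (+) n ` {..<m}" for i
    by (cases "i < n") (auto simp: image_iff intro!: bexI[of _ "i - n"])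
qed

lemma chevet_saphar_nonneg: "0 \<le> chevet_saphar sZ sX p u"
  by (simp add: chevet_saphar_def)

text \<open>At a bilinear form this is homogeneity in one argument; at any other map both sides have
  the default value 0.\<close>

lemma tensor_scale_left: "tensor sZ sX (sZ a z) x = tensor_scale a (tensor sZ sX z x)"
  and tensor_scale_right: "tensor sZ sX z (sX a x) = tensor_scale a (tensor sZ sX z x)"
  by (auto simp: tensor_def tensor_scale_def bilinear_form_def linear_iff_vector_space)

lemma tensor_scale_sum: "tensor_scale a (\<Sum>i<n. f i) = (\<Sum>i<n. tensor_scale a (f i))" for n :: nat
  by (simp add: fun_eq_iff tensor_scale_def tensor_sum_apply sum_distrib_left)

lemma tensor_space_add_rep:
  "(\<Sum>i<n. tensor sZ sX (z i) (x i)) + (\<Sum>j<m. tensor sZ sX (z' j) (x' j)) =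
    (\<Sum>i<n + m. tensor sZ sX (if i < n then z i else z' (i - n)) (if i < n then x i else x' (i - n)))"
  for n m :: nat
  by (simp add: sum_lessThan_add)

lemma tensor_in_space: "(\<Sum>i<n. tensor sZ sX (z i) (x i)) \<in> tensor_space sZ sX" for n :: nat
  by (auto simp: tensor_space_def)

lemma chevet_saphar_le:
  assumes u: "u = (\<Sum>i<n. tensor sZ sX (z i) (x i))" and AB: "0 \<le> A" "0 \<le> B"
    and A: "weak_norm sZ (conjugate p) {..<n} z \<le> ennreal A" and B: "strong_norm p {..<n} x \<le> ennreal B"
  shows "chevet_saphar sZ sX p u \<le> A * B"
proof -
  have "Inf {weak_norm sZ (conjugate p) {..<n} z * strong_norm p {..<n} x |n z x.
      u = (\<Sum>i<n. tensor sZ sX (z i) (x i))} \<le> weak_norm sZ (conjugate p) {..<n} z * strong_norm p {..<n} x"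
    using u by (intro Inf_lower) auto
  also have "\<dots> \<le> ennreal (A * B)" using A B AB by (simp add: ennreal_mult mult_mono)
  finally show ?thesis using AB unfolding chevet_saphar_def by (intro enn2real_leI) auto
qed

context
  fixes sX :: "'k::real_or_complex \<Rightarrow> 'x::banach \<Rightarrow> 'x" and sZ :: "'k \<Rightarrow> 'z::banach \<Rightarrow> 'z" and p :: ennreal
  assumes X: "banach_space sX" and Z: "banach_space sZ" and p: "1 \<le> p"
begin

private lemma p'_ge_1: "1 \<le> conjugate p"
  by (rule conjugate_ge_1[OF p])

text \<open>A representation with product below \<open>d\<close> is rescaled so that each factor
  receives its share of d = d^(1/p') * d^(1/p). In this form the bounds of two representations add
  up under concatenation.\<close>

lemma chevet_saphar_balanced:
  assumes u: "u \<in> tensor_space sZ sX" and d: "chevet_saphar sZ sX p u < d"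
  obtains n z x where "u = (\<Sum>i<n. tensor sZ sX (z i) (x i))"
    "weak_norm sZ (conjugate p) {..<n} z \<le> ennreal (d powr enn2real (inverse (conjugate p)))"
    "strong_norm p {..<n} x \<le> ennreal (d powr enn2real (inverse p))"
proof -
  define e e' where "e = enn2real (inverse p)" and "e' = enn2real (inverse (conjugate p))"
  have e: "e' + e = 1" using inverse_conjugate_sum[OF p] by (simp add: e_def e'_def)
  have d0: "0 < d" using d chevet_saphar_nonneg by (rule le_less_trans[rotated])
  define C where "C = {weak_norm sZ (conjugate p) {..<n} z * strong_norm p {..<n} x |n z x.
      u = (\<Sum>i<n. tensor sZ sX (z i) (x i))}"
  have fin: "weak_norm sZ (conjugate p) {..<n} z < top" "strong_norm p {..<n} x < top" for n z and x :: "nat \<Rightarrow> 'x"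
    using weak_norm_finite[OF p'_ge_1] strong_norm_finite[OF p, of "{..<n}" x] by auto
  obtain n :: nat and z x where "u = (\<Sum>i<n. tensor sZ sX (z i) (x i))"
    using u by (auto simp: tensor_space_def)
  then have "Inf C \<le> weak_norm sZ (conjugate p) {..<n} z * strong_norm p {..<n} x"
    unfolding C_def by (intro Inf_lower) blast
  \<comment> \<open>Finiteness matters: \<open>enn2real\<close> sends \<open>top\<close> to 0, so an
    infinite infimum would also satisfy the strict bound by \<open>d\<close>.\<close>
  then have "Inf C < top" using fin by (meson ennreal_mult_less_top le_less_trans)
  moreover have "enn2real (Inf C) < d" using d by (simp add: chevet_saphar_def C_def)
  ultimately have "Inf C < ennreal d" by (cases "Inf C") (auto intro: ennreal_lessI)
  then obtain c where "c \<in> C" "c < ennreal d" using Inf_less_iff by blast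
  then obtain n z x where u: "u = (\<Sum>i<n. tensor sZ sX (z i) (x i))"
    and c: "weak_norm sZ (conjugate p) {..<n} z * strong_norm p {..<n} x < ennreal d"
    by (auto simp: C_def)
  obtain A B where A: "weak_norm sZ (conjugate p) {..<n} z = ennreal A" "0 \<le> A"
    and B: "strong_norm p {..<n} x = ennreal B" "0 \<le> B"
    using fin by (metis ennreal_cases order_less_irrefl)
  have AB: "A * B < d" using c A B by (simp add: ennreal_mult[symmetric] ennreal_less_iff)
  \<comment> \<open>If A = 0, any large \<open>t\<close> works, and the summand 1 in the witness
    keeps \<open>t\<close> positive when B = 0. Otherwise \<open>t\<close> makes the first bound an
    equality, and A * B < d yields the second.\<close>
  obtain t where t: "0 < t" "t * A \<le> d powr e'" "1 / t * B \<le> d powr e"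
  proof (cases "A = 0")
    case True
    have "B \<le> (B / d powr e + 1) * d powr e" using d0 by (simp add: field_simps)
    moreover have "0 < B / d powr e + 1" using B(2) by (simp add: add_nonneg_pos)
    ultimately show ?thesis using True that[of "B / d powr e + 1"] by (simp add: divide_le_eq mult.commute)
  next
    case False
    then have A: "0 < A" using A by simp
    have "d powr e' * d powr e = d" using d0 by (simp flip: powr_add add: e)
    then have "A * B / d powr e' \<le> d powr e" using AB d0 by (simp add: divide_le_eq mult.commute)
    then show ?thesis using A d0 that[of "d powr e' / A"] by (simp add: mult.commute)
  qed
  have "u = (\<Sum>i<n. tensor sZ sX (t *\<^sub>R z i) ((1 / t) *\<^sub>R x i))"
  proof -
    have "tensor sZ sX (t *\<^sub>R z i) ((1 / t) *\<^sub>R x i) = tensor sZ sX (z i) (x i)" for i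
    proof -
      have "tensor sZ sX (t *\<^sub>R z i) ((1 / t) *\<^sub>R x i) =
          tensor sZ sX (sZ (of_real t) (z i)) (sX (of_real (1 / t)) (x i))"
        by (simp only: banach_space_of_real[OF X] banach_space_of_real[OF Z])
      also have "\<dots> = tensor sZ sX (z i) (x i)"
        unfolding tensor_scale_left tensor_scale_right using t(1) by (simp add: tensor_scale_def)
      finally show ?thesis .
    qed
    then show ?thesis using u by simp
  qed
  moreover have "weak_norm sZ (conjugate p) {..<n} (\<lambda>i. t *\<^sub>R z i) \<le> ennreal (d powr e')"
    using weak_norm_scaleR_le[OF p'_ge_1, of t sZ "{..<n}" z] t A
    by (auto simp: ennreal_mult[symmetric] intro: order_trans ennreal_leI)
  moreover have "strong_norm p {..<n} (\<lambda>i. (1 / t) *\<^sub>R x i) \<le> ennreal (d powr e)"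
  proof -
    have "strong_norm p {..<n} (\<lambda>i. (1 / t) *\<^sub>R x i) \<le> ennreal (1 / t) * strong_norm p {..<n} x"
      using t by (intro strong_norm_scale_le p) auto
    also have "\<dots> = ennreal (1 / t * B)" using t B by (simp only: B ennreal_mult[symmetric] zero_le_divide_1_iff less_imp_le)
    also have "\<dots> \<le> ennreal (d powr e)" using t by (intro ennreal_leI)
    finally show ?thesis .
  qed
  ultimately show ?thesis using that by (simp add: e_def e'_def)
qed

text \<open>Balanced representations for bounds a and b just above the two values are concatenated.
  The weak norm is then at most (a + b)^(1/p') and the strong norm at most (a + b)^(1/p), with
  product a + b.\<close>

lemma chevet_saphar_add:
  assumes u: "u \<in> tensor_space sZ sX" and v: "v \<in> tensor_space sZ sX"
  shows "chevet_saphar sZ sX p (u + v) \<le> chevet_saphar sZ sX p u + chevet_saphar sZ sX p v"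
proof (rule field_le_epsilon)
  fix d :: real assume d: "0 < d"
  let ?q = "conjugate p"
  define e e' where "e = enn2real (inverse p)" and "e' = enn2real (inverse ?q)"
  have e: "e' + e = 1" using inverse_conjugate_sum[OF p] by (simp add: e_def e'_def)
  define a b where "a = chevet_saphar sZ sX p u + d / 2" and "b = chevet_saphar sZ sX p v + d / 2"
  have ab: "0 < a" "0 < b" using d unfolding a_def b_def by (auto intro!: add_nonneg_pos chevet_saphar_nonneg)
  have lt: "chevet_saphar sZ sX p u < a" "chevet_saphar sZ sX p v < b" using d by (simp_all add: a_def b_def)
  obtain n z x where 1: "u = (\<Sum>i<n. tensor sZ sX (z i) (x i))"
    "weak_norm sZ ?q {..<n} z \<le> ennreal (a powr e')" "strong_norm p {..<n} x \<le> ennreal (a powr e)"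
    by (rule chevet_saphar_balanced[OF u lt(1), folded e_def e'_def])
  obtain m z' x' where 2: "v = (\<Sum>i<m. tensor sZ sX (z' i) (x' i))"
    "weak_norm sZ ?q {..<m} z' \<le> ennreal (b powr e')" "strong_norm p {..<m} x' \<le> ennreal (b powr e)"
    by (rule chevet_saphar_balanced[OF v lt(2), folded e_def e'_def])
  define z'' where "z'' i = (if i < n then z i else z' (i - n))" for i
  define x'' where "x'' i = (if i < n then x i else x' (i - n))" for i
  have inj: "inj_on ((+) n) {..<m}" by simp
  have "weak_norm sZ ?q {..<n} z'' = weak_norm sZ ?q {..<n} z"
    using p'_ge_1 by (intro weak_norm_cong) (auto simp: z''_def)
  moreover have "weak_norm sZ ?q ((+) n ` {..<m}) z'' = weak_norm sZ ?q {..<m} z'"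
    using weak_norm_reindex[OF p'_ge_1 inj, of sZ z''] by (simp add: z''_def)
  ultimately have "weak_norm sZ ?q {..<n + m} z'' \<le> ennreal ((a + b) powr e')"
    unfolding lessThan_add using 1 2 ab by (intro weak_norm_Un_powr p'_ge_1 e'_def) auto
  moreover have "strong_norm p {..<n} x'' = strong_norm p {..<n} x"
    using p by (intro strong_norm_cong_norm) (auto simp: x''_def)
  moreover have "strong_norm p ((+) n ` {..<m}) x'' = strong_norm p {..<m} x'"
    using strong_norm_reindex[OF p inj, of x''] by (simp add: x''_def)
  ultimately have "weak_norm sZ ?q {..<n + m} z'' \<le> ennreal ((a + b) powr e')"
    "strong_norm p {..<n + m} x'' \<le> ennreal ((a + b) powr e)"
    unfolding lessThan_add using 1 2 ab by (auto intro!: strong_norm_Un_powr p e_def)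
  moreover have "u + v = (\<Sum>i<n + m. tensor sZ sX (z'' i) (x'' i))"
    by (simp add: 1 2 tensor_space_add_rep z''_def x''_def)
  ultimately have "chevet_saphar sZ sX p (u + v) \<le> (a + b) powr e' * (a + b) powr e"
    by (intro chevet_saphar_le) auto
  also have "\<dots> = a + b" using ab by (simp flip: powr_add add: e)
  also have "\<dots> = chevet_saphar sZ sX p u + chevet_saphar sZ sX p v + d" by (simp add: a_def b_def)
  finally show "chevet_saphar sZ sX p (u + v) \<le> chevet_saphar sZ sX p u + chevet_saphar sZ sX p v + d" .
qed

lemma chevet_saphar_scale:
  assumes u: "u \<in> tensor_space sZ sX"
  shows "chevet_saphar sZ sX p (tensor_scale a u) \<le> norm a * chevet_saphar sZ sX p u"
proof (rule field_le_epsilon)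
  fix d :: real assume d: "0 < d"
  let ?q = "conjugate p"
  define e e' where "e = enn2real (inverse p)" and "e' = enn2real (inverse ?q)"
  have e: "e' + e = 1" using inverse_conjugate_sum[OF p] by (simp add: e_def e'_def)
  \<comment> \<open>The margin is chosen so that its multiple by |a| is at most \<open>d\<close>;
    the 1 in the denominator covers a = 0.\<close>
  define b where "b = chevet_saphar sZ sX p u + d / (norm a + 1)"
  have na: "0 < norm a + 1" by (simp add: add_nonneg_pos)
  have b: "0 < b" using d na unfolding b_def by (auto intro!: add_nonneg_pos chevet_saphar_nonneg)
  have lt: "chevet_saphar sZ sX p u < b" using d na by (simp add: b_def)
  obtain n z x where 1: "u = (\<Sum>i<n. tensor sZ sX (z i) (x i))"
    "weak_norm sZ ?q {..<n} z \<le> ennreal (b powr e')" "strong_norm p {..<n} x \<le> ennreal (b powr e)"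
    by (rule chevet_saphar_balanced[OF u lt, folded e_def e'_def])
  have "tensor_scale a u = (\<Sum>i<n. tensor sZ sX (z i) (sX a (x i)))"
    by (simp add: 1 tensor_scale_sum tensor_scale_right)
  moreover have "strong_norm p {..<n} (\<lambda>i. sX a (x i)) \<le> ennreal (norm a * b powr e)"
  proof -
    have "strong_norm p {..<n} (\<lambda>i. sX a (x i)) \<le> ennreal (norm a) * strong_norm p {..<n} x"
      by (intro strong_norm_scale_le p) (auto simp: banach_space_norm[OF X])
    also have "\<dots> \<le> ennreal (norm a * b powr e)" using 1 by (simp add: ennreal_mult mult_left_mono)
    finally show ?thesis .
  qed
  ultimately have "chevet_saphar sZ sX p (tensor_scale a u) \<le> b powr e' * (norm a * b powr e)"
    using 1 by (intro chevet_saphar_le) auto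
  also have "\<dots> = norm a * (b powr (e' + e))" by (simp add: powr_add)
  also have "\<dots> = norm a * chevet_saphar sZ sX p u + norm a / (norm a + 1) * d"
    using b by (simp add: e b_def distrib_left)
  also have "\<dots> \<le> norm a * chevet_saphar sZ sX p u + 1 * d"
    using d na by (intro add_left_mono mult_right_mono) auto
  finally show "chevet_saphar sZ sX p (tensor_scale a u) \<le> norm a * chevet_saphar sZ sX p u + d" by simp
qed

lemma seminormed_space_tensor:
  "seminormed_space tensor_scale (tensor_space sZ sX) (chevet_saphar sZ sX p)"
proof
  show "0 \<in> tensor_space sZ sX" using tensor_in_space[where n = 0] by simp
  show "u + v \<in> tensor_space sZ sX" if "u \<in> tensor_space sZ sX" "v \<in> tensor_space sZ sX" for u v
  proof -
    obtain n m :: nat and z z' x x' where "u = (\<Sum>i<n. tensor sZ sX (z i) (x i))" "v = (\<Sum>i<m. tensor sZ sX (z' i) (x' i))"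
      using \<open>u \<in> _\<close> \<open>v \<in> _\<close> unfolding tensor_space_def by blast
    then show ?thesis by (simp only: tensor_space_add_rep tensor_in_space)
  qed
  show "tensor_scale a u \<in> tensor_space sZ sX" if "u \<in> tensor_space sZ sX" for a u
  proof -
    obtain n :: nat and z x where "u = (\<Sum>i<n. tensor sZ sX (z i) (x i))"
      using \<open>u \<in> _\<close> unfolding tensor_space_def by blast
    then show ?thesis
      by (simp only: tensor_scale_sum tensor_scale_right[symmetric] tensor_in_space)
  qed
  show "chevet_saphar sZ sX p 0 = 0"
  proof -
    have "chevet_saphar sZ sX p 0 \<le> 0 * 0"
      by (rule chevet_saphar_le[where n = 0 and z = "\<lambda>_. 0" and x = "\<lambda>_. 0"]) (simp_all add: p weak_norm_zero[OF p'_ge_1])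
    then show ?thesis using chevet_saphar_nonneg[of sZ sX p 0] by simp
  qed
qed (simp_all add: chevet_saphar_nonneg chevet_saphar_add chevet_saphar_scale,
    simp_all add: tensor_scale_def fun_eq_iff right_diff_distrib)

end


section \<open>The equivalences\<close>

text \<open>Statement (b) for a given constant, and below it (b') for a given constant, so that
  constants can be carried from one statement to another.\<close>

definition finitely_bounded ::
  "('k::real_or_complex \<Rightarrow> 'z::banach \<Rightarrow> 'z) \<Rightarrow> ('k \<Rightarrow> 'y::banach \<Rightarrow> 'y) \<Rightarrow> ennreal \<Rightarrow>
   ('z \<Rightarrow>\<^sub>L ('x::banach \<Rightarrow>\<^sub>L 'y)) \<Rightarrow> real \<Rightarrow> bool" where
  "finitely_bounded sZ sY q S c \<longleftrightarrow> (\<forall>n x z. weak_norm sY q {..<n} (\<lambda>i. blinfun_apply (blinfun_apply S (z i)) (x i))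
     \<le> ennreal c * strong_norm \<infinity> {..<n} x * weak_norm sZ q {..<n} z)"

definition tail_bounded ::
  "('k::real_or_complex \<Rightarrow> 'z::banach \<Rightarrow> 'z) \<Rightarrow> ('k \<Rightarrow> 'y::banach \<Rightarrow> 'y) \<Rightarrow> ennreal \<Rightarrow>
   ('z \<Rightarrow>\<^sub>L ('x::banach \<Rightarrow>\<^sub>L 'y)) \<Rightarrow> real \<Rightarrow> bool" where
  "tail_bounded sZ sY q S c \<longleftrightarrow> (\<forall>x z. bounded (range x) \<and> z \<in> weakly_summable sZ q \<longrightarrow>
     (\<forall>n. weak_norm sY q {n..} (\<lambda>i. blinfun_apply (blinfun_apply S (z i)) (x i))
        \<le> ennreal c * strong_norm \<infinity> {n..} x * weak_norm sZ q {n..} z))"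

lemma strong_norm_infinity_bounded:
  assumes "bounded (range x)"
  shows "strong_norm \<infinity> I x < top"
proof -
  obtain B where "0 < B" "\<And>i. norm (x i) \<le> B" using assms by (auto simp: bounded_pos)
  then have "strong_norm top I x \<le> ennreal B" by (subst strong_norm_infinity_le_iff) auto
  then show ?thesis by (auto intro: le_less_trans)
qed

lemma strong_norm_infinity_tail_tendsto:
  fixes x :: "nat \<Rightarrow> 'x::real_normed_vector"
  assumes "x \<longlonglongrightarrow> 0"
  shows "(\<lambda>N. strong_norm \<infinity> {N..} x) \<longlonglongrightarrow> 0"
proof (rule order_tendstoI)
  fix a :: ennreal assume "0 < a"
  then obtain r where r: "0 < r" "ennreal r < a"
    by (metis dense ennreal_cases ennreal_less_zero_iff less_top_ennreal order_less_irrefl top_greatest less_le_not_le)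
  obtain N where N: "\<And>i. i \<ge> N \<Longrightarrow> norm (x i) < r" using assms r(1) by (metis LIMSEQ_D diff_zero)
  have "strong_norm \<infinity> {n..} x < a" if "N \<le> n" for n
  proof -
    have "norm (x i) \<le> r" if "i \<in> {n..}" for i using N[of i] that \<open>N \<le> n\<close> by simp
    then have "strong_norm top {n..} x \<le> ennreal r"
      using r by (subst strong_norm_infinity_le_iff) auto
    then show ?thesis using r by (auto intro: le_less_trans)
  qed
  then show "\<forall>\<^sub>F n in sequentially. strong_norm \<infinity> {n..} x < a" by (auto simp: eventually_sequentially)
qed auto

lemma ennreal_tendsto_zero_dominated:
  fixes f g :: "nat \<Rightarrow> ennreal"
  assumes "g \<longlonglongrightarrow> 0" "C < top" "\<And>n. f n \<le> C * g n"
  shows "f \<longlonglongrightarrow> 0"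
proof (rule tendsto_sandwich[OF _ _ tendsto_const])
  show "(\<lambda>n. C * g n) \<longlonglongrightarrow> 0" using ennreal_tendsto_cmult[OF assms(2,1)] by simp
qed (use assms in auto)

lemma sum_half_powers_le: "(\<Sum>k\<in>{m..<n}. (1/2)^k) \<le> 2 * (1/2::real)^m"
proof (cases "m \<le> n")
  case True
  then have "(\<Sum>k\<in>{m..<n}. (1/2)^k) = 2 * (1/2)^m - 2 * (1/2::real)^n"
    by (induction rule: dec_induct) simp_all
  then show ?thesis by simp
qed simp

context
  fixes sX :: "'k::real_or_complex \<Rightarrow> 'x::banach \<Rightarrow> 'x"
    and sY :: "'k \<Rightarrow> 'y::banach \<Rightarrow> 'y"
    and sZ :: "'k \<Rightarrow> 'z::banach \<Rightarrow> 'z"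
    and p :: ennreal
    and S :: "'z \<Rightarrow>\<^sub>L ('x \<Rightarrow>\<^sub>L 'y)"
  assumes X: "banach_space sX" and Y: "banach_space sY" and Z: "banach_space sZ"
    and p: "1 \<le> p" and S: "S \<in> operators2 sZ sX sY"
begin

private abbreviation (input) ev :: "'z \<Rightarrow> 'x \<Rightarrow> 'y" where
  "ev z x \<equiv> blinfun_apply (blinfun_apply S z) x"

private lemma q: "1 \<le> conjugate p"
  by (rule conjugate_ge_1[OF p])

private lemma ev_linear: "ev z (x + x') = ev z x + ev z x'" "ev (z + z') x = ev z x + ev z' x"
    "ev z (r *\<^sub>R x) = r *\<^sub>R ev z x" "ev (r *\<^sub>R z) x = r *\<^sub>R ev z x" "ev z 0 = 0" "ev 0 x = 0"
    "ev z (sX a x) = sY a (ev z x)" "ev (sZ a z) x = sY a (ev z x)"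
  using S by (auto simp: blinfun.bilinear_simps operators2_def operators_def linear_iff_vector_space)

section \<open>From finite systems to tails of sequences\<close>

lemma finitely_bounded_imp_tail_bounded:
  assumes c: "0 < c" and b: "finitely_bounded sZ sY (conjugate p) S c"
  shows "tail_bounded sZ sY (conjugate p) S c"
  unfolding tail_bounded_def
proof (intro allI impI, goal_cases)
  case (1 x z n)
  let ?q = "conjugate p"
  show ?case
  proof (cases "ennreal c * strong_norm \<infinity> {n..} x * weak_norm sZ ?q {n..} z")
    case (real t)
    have "weak_norm sY ?q F (\<lambda>i. ev (z i) (x i)) \<le> ennreal t" if F: "finite F" "F \<subseteq> {n..}" for F
    proof -
      \<comment> \<open>Finite systems start at index 0 but the tail starts at \<open>n\<close>.
        Both sequences are therefore set to 0 before \<open>n\<close>, which keeps their norms over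
        {..<m} below the norms of the tails.\<close>
      obtain m where m: "F \<subseteq> {..<m}" using F finite_nat_iff_bounded by blast
      define x' where "x' i = (if i \<in> {n..} then x i else 0)" for i
      define z' where "z' i = (if i \<in> {n..} then z i else 0)" for i
      have "weak_norm sY ?q F (\<lambda>i. ev (z i) (x i)) = weak_norm sY ?q F (\<lambda>i. ev (z' i) (x' i))"
        using F q by (intro weak_norm_cong) (auto simp: x'_def z'_def)
      also have "\<dots> \<le> weak_norm sY ?q {..<m} (\<lambda>i. ev (z' i) (x' i))" by (intro weak_norm_mono q m)
      also have "\<dots> \<le> ennreal c * strong_norm \<infinity> {..<m} x' * weak_norm sZ ?q {..<m} z'"
        using b by (simp add: finitely_bounded_def)
      also have "weak_norm sZ ?q {..<m} z' = weak_norm sZ ?q ({..<m} \<inter> {n..}) z"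
        unfolding z'_def by (rule weak_norm_truncate[OF q])
      also have "ennreal c * strong_norm \<infinity> {..<m} x' * \<dots> \<le>
          ennreal c * strong_norm \<infinity> {n..} x * weak_norm sZ ?q {n..} z"
      proof (intro mult_mono order_refl)
        show "strong_norm \<infinity> {..<m} x' \<le> strong_norm \<infinity> {n..} x"
          unfolding strong_norm_def by (auto simp: x'_def intro!: SUP_least intro: SUP_upper)
      qed (auto intro: weak_norm_mono q)
      finally show ?thesis by (simp only: real)
    qed
    note le = this
    have "0 \<le> t" using real by simp
    from weak_norm_le_finite_subsets[OF q this le]
    have "weak_norm sY ?q {n..} (\<lambda>i. ev (z i) (x i)) \<le> ennreal t" .
    then show ?thesis by (simp only: real)
  qed simp
qed

text \<open>One factor is replaced by its norm over all indices. With \<open>z\<close> frozen, the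
  tails of a null sequence \<open>x\<close> give (d); with \<open>x\<close> frozen, the tails of an
  unconditionally summable \<open>z\<close> give the alternative version.\<close>

lemma tail_bounded_estimates:
  assumes b': "tail_bounded sZ sY (conjugate p) S c"
    and x: "bounded (range x)" and z: "z \<in> weakly_summable sZ (conjugate p)"
  defines "y \<equiv> \<lambda>i. ev (z i) (x i)"
  shows "weak_norm sY (conjugate p) UNIV y < top"
    and "\<exists>C<top. \<forall>N. weak_norm sY (conjugate p) {N..} y \<le> C * strong_norm \<infinity> {N..} x"
    and "\<exists>C<top. \<forall>N. weak_norm sY (conjugate p) {N..} y \<le> C * weak_norm sZ (conjugate p) {N..} z"
proof -
  let ?q = "conjugate p"
  have le: "weak_norm sY ?q {n..} y \<le> ennreal c * strong_norm \<infinity> {n..} x * weak_norm sZ ?q {n..} z" for n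
    using b' x z by (simp add: tail_bounded_def y_def)
  have x': "strong_norm \<infinity> UNIV x < top" by (rule strong_norm_infinity_bounded[OF x])
  have z': "weak_norm sZ ?q UNIV z < top" using z weakly_summable_iff[OF Z p] by blast
  show "\<exists>C<top. \<forall>N. weak_norm sY ?q {N..} y \<le> C * strong_norm \<infinity> {N..} x"
  proof (intro exI[of _ "ennreal c * weak_norm sZ ?q UNIV z"] conjI allI)
    show "weak_norm sY ?q {N..} y \<le> ennreal c * weak_norm sZ ?q UNIV z * strong_norm \<infinity> {N..} x" for N
      using le[of N] mult_left_mono[OF weak_norm_mono[OF q, of "{N..}" UNIV sZ z],
          of "ennreal c * strong_norm \<infinity> {N..} x"]
      by (simp add: mult_ac)
  qed (use z' in \<open>simp add: ennreal_mult_less_top\<close>)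
  show "\<exists>C<top. \<forall>N. weak_norm sY ?q {N..} y \<le> C * weak_norm sZ ?q {N..} z"
  proof (intro exI[of _ "ennreal c * strong_norm \<infinity> UNIV x"] conjI allI)
    have "strong_norm \<infinity> {N..} x \<le> strong_norm \<infinity> UNIV x" for N by (intro strong_norm_mono) auto
    then show "weak_norm sY ?q {N..} y \<le> ennreal c * strong_norm \<infinity> UNIV x * weak_norm sZ ?q {N..} z" for N
      using le[of N] by (meson mult_left_mono mult_right_mono order_trans zero_le)
  qed (use x' in \<open>simp add: ennreal_mult_less_top\<close>)
  have "{0..} = (UNIV :: nat set)" by auto
  then have "weak_norm sY ?q UNIV y \<le> ennreal c * strong_norm \<infinity> UNIV x * weak_norm sZ ?q UNIV z"
    using le[of 0] by simp
  also have "\<dots> < top" using x' z' by (simp add: ennreal_mult_less_top)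
  finally show "weak_norm sY ?q UNIV y < top" .
qed

section \<open>Counterexamples assembled in blocks\<close>

lemma not_finitely_bounded_normalized:
  assumes nb: "\<And>c. 0 < c \<Longrightarrow> \<not> finitely_bounded sZ sY (conjugate p) S c"
  shows "\<exists>n x z. (\<forall>i<n. norm (x i) \<le> (1/2)^k) \<and> weak_norm sZ (conjugate p) {..<n} z \<le> ennreal ((1/2)^k) \<and>
    ennreal (2^k) \<le> weak_norm sY (conjugate p) {..<n} (\<lambda>i. ev (z i) (x i))"
proof -
  let ?q = "conjugate p"
  \<comment> \<open>The constant is 8^k = 4^k * 2^k: normalizing \<open>x\<close> and
    \<open>z\<close> to size 2^(-k) each costs 4^k in the product, and 2^k is left over.\<close>
  obtain n x z where gt: "ennreal (8^k) * strong_norm \<infinity> {..<n} x * weak_norm sZ ?q {..<n} z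
      < weak_norm sY ?q {..<n} (\<lambda>i. ev (z i) (x i))"
    using nb[of "8^k"] by (auto simp: finitely_bounded_def not_le)
  obtain A where A: "strong_norm \<infinity> {..<n} x = ennreal A" "0 \<le> A"
    using strong_norm_finite[of \<infinity> "{..<n}" x] by (cases "strong_norm \<infinity> {..<n} x") auto
  obtain W where W: "weak_norm sZ ?q {..<n} z = ennreal W" "0 \<le> W"
    using weak_norm_finite[OF q, of "{..<n}" sZ z] by (cases "weak_norm sZ ?q {..<n} z") auto
  have xA: "norm (x i) \<le> A" if "i < n" for i
    using norm_le_strong_norm[of \<infinity> i "{..<n}" x] that A by simp
  have zW: "norm (z i) \<le> W" if "i < n" for i
    using norm_le_weak_norm[OF Z q, of i "{..<n}" z] that W by simp
  \<comment> \<open>If \<open>A\<close> or \<open>W\<close> were 0, all images would vanish, against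
    the strict inequality \<open>gt\<close>. Hence dividing by them is legitimate.\<close>
  have "A \<noteq> 0"
  proof
    assume "A = 0"
    then have "weak_norm sY ?q {..<n} (\<lambda>i. ev (z i) (x i)) = 0"
      using xA by (intro weak_norm_zero q) (auto simp: ev_linear)
    then show False using gt by simp
  qed
  moreover have "W \<noteq> 0"
  proof
    assume "W = 0"
    then have "weak_norm sY ?q {..<n} (\<lambda>i. ev (z i) (x i)) = 0"
      using zW by (intro weak_norm_zero q) (auto simp: ev_linear)
    then show False using gt by simp
  qed
  ultimately have pos: "0 < A" "0 < W" using A W by auto
  define a where "a = (1/2)^k / A"
  define w where "w = (1/2)^k / W"
  have aw: "0 < a" "0 < w" using pos by (simp_all add: a_def w_def)
  let ?x = "\<lambda>i. a *\<^sub>R x i" and ?z = "\<lambda>i. w *\<^sub>R z i"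
  have "norm (?x i) \<le> (1/2)^k" if "i < n" for i
    using xA[OF that] pos mult_left_mono[OF xA[OF that], of a] aw by (simp add: a_def)
  moreover have "weak_norm sZ ?q {..<n} ?z \<le> ennreal ((1/2)^k)"
  proof -
    have "weak_norm sZ ?q {..<n} ?z \<le> ennreal w * ennreal W"
      using weak_norm_scaleR_le[OF q, of w sZ "{..<n}" z] aw W by simp
    also have "\<dots> = ennreal ((1/2)^k)" using pos aw by (simp add: ennreal_mult[symmetric] w_def)
    finally show ?thesis .
  qed
  moreover have "ennreal (2^k) \<le> weak_norm sY ?q {..<n} (\<lambda>i. ev (?z i) (?x i))"
  proof (cases "weak_norm sY ?q {..<n} (\<lambda>i. ev (?z i) (?x i))")
    case (real r)
    \<comment> \<open>The factor \<open>4^k * A * W\<close> is the inverse of \<open>a * w\<close>,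
      so it undoes the normalization of both arguments.\<close>
    have "weak_norm sY ?q {..<n} (\<lambda>i. ev (z i) (x i)) =
        weak_norm sY ?q {..<n} (\<lambda>i. (4^k * A * W) *\<^sub>R ev (?z i) (?x i))"
      using pos q by (intro weak_norm_cong) (simp_all add: ev_linear a_def w_def power_divide flip: power_mult_distrib)
    also have "\<dots> \<le> ennreal (4^k * A * W) * ennreal r"
      using weak_norm_scaleR_le[OF q, of "4^k * A * W" sY "{..<n}" "\<lambda>i. ev (?z i) (?x i)"] pos real by simp
    also have "\<dots> = ennreal (4^k * A * W * r)" using pos real by (simp add: ennreal_mult)
    finally have "ennreal (8^k) * ennreal A * ennreal W < ennreal (4^k * A * W * r)"
      using gt unfolding A(1) W(1) by (rule less_le_trans[rotated])
    then have "ennreal (8^k * A * W) < ennreal (4^k * A * W * r)" using pos by (simp add: ennreal_mult)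
    then have "8^k * A * W < 4^k * A * W * r" using pos by (simp add: ennreal_less_iff)
    moreover have "(8::real)^k = 4^k * 2^k" using power_mult_distrib[of "4::real" 2 k] by simp
    ultimately have "(4^k * A * W) * 2^k < (4^k * A * W) * r" by (simp only: mult_ac)
    then have "2^k < r" using pos by (subst (asm) mult_less_cancel_left_pos) simp_all
    then show ?thesis using real by (simp add: ennreal_leI)
  qed simp
  ultimately show ?thesis by (intro exI[of _ n] exI[of _ ?x] exI[of _ ?z] conjI) auto
qed

text \<open>Block \<open>k\<close> occupies the indices \<open>prod_encode (k, j)\<close> with \<open>j < N k\<close>; all other entries are zero.\<close>
lemma not_finitely_bounded_sequences:
  assumes nb: "\<And>c. 0 < c \<Longrightarrow> \<not> finitely_bounded sZ sY (conjugate p) S c"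
  shows "\<exists>x z. x \<longlonglongrightarrow> 0 \<and> z \<in> unconditionally_summable sZ (conjugate p) \<and>
    (\<lambda>i. ev (z i) (x i)) \<notin> weakly_summable sY (conjugate p)"
proof -
  let ?q = "conjugate p"
  define P where "P k n x z \<longleftrightarrow> (\<forall>i<n. norm (x i) \<le> (1/2)^k) \<and> weak_norm sZ ?q {..<n} z \<le> ennreal ((1/2)^k) \<and>
    ennreal (2^k) \<le> weak_norm sY ?q {..<n} (\<lambda>i. ev (z i) (x i))" for k :: nat and n x z
  have "\<exists>n x z. P k n x z" for k
    unfolding P_def by (rule not_finitely_bounded_normalized[OF nb])
  then obtain N X' Z' where "\<And>k. P k (N k) (X' k) (Z' k)" by metis
  then have X': "\<And>k i. i < N k \<Longrightarrow> norm (X' k i) \<le> (1/2)^k"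
    and Z': "\<And>k. weak_norm sZ ?q {..<N k} (Z' k) \<le> ennreal ((1/2)^k)"
    and Y': "\<And>k. ennreal (2^k) \<le> weak_norm sY ?q {..<N k} (\<lambda>i. ev (Z' k i) (X' k i))"
    by (simp_all add: P_def)
  define bl where "bl k = (\<lambda>j. prod_encode (k, j)) ` {..<N k}" for k
  define K J where "K i = fst (prod_decode i)" and "J i = snd (prod_decode i)" for i
  have KJ: "K (prod_encode (k, j)) = k" "J (prod_encode (k, j)) = j" for k j by (simp_all add: K_def J_def)
  have in_bl: "i \<in> bl (K i)" if "J i < N (K i)" for i
    using that unfolding bl_def by (intro image_eqI[of _ _ "J i"]) (simp_all add: K_def J_def)
  define x where "x i = (if J i < N (K i) then X' (K i) (J i) else 0)" for i
  define z where "z i = (if J i < N (K i) then Z' (K i) (J i) else 0)" for i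
  have inj: "inj_on (\<lambda>j. prod_encode (k, j)) {..<N k}" for k by (auto intro!: inj_onI)
  have bl_z: "weak_norm sZ ?q (bl k) z \<le> ennreal ((1/2)^k)" for k
  proof -
    have "weak_norm sZ ?q (bl k) z = weak_norm sZ ?q {..<N k} (\<lambda>j. z (prod_encode (k, j)))"
      unfolding bl_def by (rule weak_norm_reindex[OF q inj])
    also have "\<dots> = weak_norm sZ ?q {..<N k} (Z' k)" using q by (intro weak_norm_cong) (auto simp: z_def KJ)
    finally show ?thesis using Z' by simp
  qed
  have bl_y: "ennreal (2^k) \<le> weak_norm sY ?q (bl k) (\<lambda>i. ev (z i) (x i))" for k
  proof -
    have "weak_norm sY ?q (bl k) (\<lambda>i. ev (z i) (x i)) =
        weak_norm sY ?q {..<N k} (\<lambda>j. ev (z (prod_encode (k, j))) (x (prod_encode (k, j))))"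
      unfolding bl_def by (rule weak_norm_reindex[OF q inj])
    also have "\<dots> = weak_norm sY ?q {..<N k} (\<lambda>i. ev (Z' k i) (X' k i))"
      using q by (intro weak_norm_cong) (auto simp: x_def z_def KJ)
    finally show ?thesis using Y' by simp
  qed
  \<comment> \<open>The blocks interleave and need not be intervals. Still, the blocks before
    \<open>m\<close> occupy finitely many indices, so from some \<open>M\<close> on every index
    inside a block belongs to block \<open>m\<close> or a later one.\<close>
  have late: "\<exists>M. \<forall>i\<ge>M. J i < N (K i) \<longrightarrow> m \<le> K i" for m
  proof -
    have "finite (\<Union>k<m. bl k)" by (simp add: bl_def)
    then obtain M where M: "(\<Union>k<m. bl k) \<subseteq> {..<M}" using finite_nat_iff_bounded by blast
    have "m \<le> K i" if "M \<le> i" "J i < N (K i)" for i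
    proof (rule ccontr)
      assume "\<not> m \<le> K i"
      then have "i \<in> (\<Union>k<m. bl k)" using in_bl[OF that(2)] by auto
      then show False using M that(1) by auto
    qed
    then show ?thesis by blast
  qed
  have "x \<longlonglongrightarrow> 0"
  proof (rule LIMSEQ_I)
    fix r :: real assume r: "0 < r"
    obtain m where m: "(1/2)^m < r" using real_arch_pow_inv[OF r, of "1/2"] by auto
    obtain M where M: "\<And>i. i \<ge> M \<Longrightarrow> J i < N (K i) \<Longrightarrow> m \<le> K i" using late by blast
    have "norm (x i - 0) < r" if "M \<le> i" for i
    proof (cases "J i < N (K i)")
      case True
      then have "norm (x i) \<le> (1/2)^K i" using X' by (simp add: x_def)
      also have "\<dots> \<le> (1/2)^m" using M[OF that True] by (intro power_decreasing) auto
      finally show ?thesis using m by simp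
    qed (simp add: x_def r)
    then show "\<exists>M. \<forall>i\<ge>M. norm (x i - 0) < r" by blast
  qed
  have tail: "weak_norm sZ ?q {M..} z \<le> ennreal (2 * (1/2)^m)"
    if M: "\<And>i. i \<ge> M \<Longrightarrow> J i < N (K i) \<Longrightarrow> m \<le> K i" for m M
  proof (rule weak_norm_le_finite_subsets[OF q])
    fix F assume F: "finite F" "F \<subseteq> {M..}"
    \<comment> \<open>Exceeds the block numbers of all indices in \<open>F\<close>; inserting
      \<open>m\<close> keeps the set nonempty for \<open>Max\<close>. Thus \<open>F\<close> lies in
      the blocks from \<open>m\<close> to \<open>L - 1\<close> together with \<open>?F\<close>,
      where \<open>z\<close> is 0.\<close>
    define L where "L = Suc (Max (insert m (K ` F)))"
    have KL: "K i < L" if "i \<in> F" for i using F that by (auto simp: L_def less_Suc_eq_le)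
    let ?F = "{i \<in> F. \<not> J i < N (K i)}"
    have "weak_norm sZ ?q F z \<le> weak_norm sZ ?q (?F \<union> (\<Union>k\<in>{m..<L}. bl k)) z"
    proof (intro weak_norm_mono q subsetI)
      fix i assume "i \<in> F"
      then have "M \<le> i" "K i < L" using F KL by auto
      then show "i \<in> ?F \<union> (\<Union>k\<in>{m..<L}. bl k)"
        using in_bl[of i] M[of i] \<open>i \<in> F\<close> by (cases "J i < N (K i)") (auto intro!: bexI[of _ "K i"])
    qed
    also have "\<dots> \<le> weak_norm sZ ?q ?F z + weak_norm sZ ?q (\<Union>k\<in>{m..<L}. bl k) z" by (rule weak_norm_Un_le[OF q])
    also have "weak_norm sZ ?q ?F z = 0" by (intro weak_norm_zero q) (auto simp: z_def)
    also have "0 + weak_norm sZ ?q (\<Union>k\<in>{m..<L}. bl k) z \<le> (\<Sum>k\<in>{m..<L}. weak_norm sZ ?q (bl k) z)"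
      using weak_norm_UN_le[OF q, of "{m..<L}" sZ bl z] by simp
    also have "\<dots> \<le> (\<Sum>k\<in>{m..<L}. ennreal ((1/2)^k))" by (intro sum_mono bl_z)
    also have "\<dots> = ennreal (\<Sum>k\<in>{m..<L}. (1/2)^k)" by (intro sum_ennreal) auto
    also have "\<dots> \<le> ennreal (2 * (1/2)^m)" by (intro ennreal_leI sum_half_powers_le)
    finally show "weak_norm sZ ?q F z \<le> ennreal (2 * (1/2)^m)" .
  qed simp
  have "weak_norm sZ ?q UNIV z < top"
  proof -
    have "{0..} = (UNIV :: nat set)" by auto
    then have "weak_norm sZ ?q UNIV z \<le> ennreal (2 * (1/2)^0)" using tail[of 0 0] by simp
    then show ?thesis by (rule le_less_trans) simp
  qed
  moreover have "(\<lambda>M. weak_norm sZ ?q {M..} z) \<longlonglongrightarrow> 0"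
  proof (rule order_tendstoI)
    fix a :: ennreal assume "0 < a"
    then obtain r where r: "0 < r" "ennreal r < a"
      by (metis dense ennreal_cases ennreal_less_zero_iff less_top_ennreal order_less_irrefl top_greatest less_le_not_le)
    obtain m where m: "(1/2)^m < r / 2" using real_arch_pow_inv[of "r / 2" "1/2"] r by auto
    obtain M where M: "\<And>i. i \<ge> M \<Longrightarrow> J i < N (K i) \<Longrightarrow> m \<le> K i" using late by blast
    have "weak_norm sZ ?q {n..} z < a" if "M \<le> n" for n
    proof -
      have "weak_norm sZ ?q {n..} z \<le> ennreal (2 * (1/2)^m)" using M that by (intro tail) auto
      also have "\<dots> \<le> ennreal r" using m by (intro ennreal_leI) simp
      finally show ?thesis using r by (auto intro: le_less_trans)
    qed
    then show "\<forall>\<^sub>F n in sequentially. weak_norm sZ ?q {n..} z < a" by (auto simp: eventually_sequentially)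
  qed auto
  ultimately have "z \<in> unconditionally_summable sZ ?q" using unconditionally_summable_iff[OF Z p] by blast
  moreover have "(\<lambda>i. ev (z i) (x i)) \<notin> weakly_summable sY ?q"
  proof
    assume "(\<lambda>i. ev (z i) (x i)) \<in> weakly_summable sY ?q"
    then have "weak_norm sY ?q UNIV (\<lambda>i. ev (z i) (x i)) < top" using weakly_summable_iff[OF Y p] by blast
    then obtain t where t: "weak_norm sY ?q UNIV (\<lambda>i. ev (z i) (x i)) = ennreal t" "0 \<le> t"
      by (cases "weak_norm sY ?q UNIV (\<lambda>i. ev (z i) (x i))") auto
    obtain k where k: "t < 2^k" using real_arch_pow[of 2 t] by auto
    have "ennreal (2^k) \<le> ennreal t"
      using bl_y[of k] weak_norm_mono[OF q, of "bl k" UNIV sY "\<lambda>i. ev (z i) (x i)"]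
      unfolding t(1) by (auto intro: order_trans)
    then show False using k t(2) by simp
  qed
  ultimately show ?thesis using \<open>x \<longlonglongrightarrow> 0\<close> by blast
qed

section \<open>Operators on the completed tensor product and finite systems\<close>

lemma tensor_operator_imp_finitely_bounded:
  assumes U: "U \<in> tensor_operators sZ sX sY p" and assoc: "associated sZ sX p U = (\<lambda>z. blinfun_apply (blinfun_apply S z))"
  shows "\<exists>c>0. finitely_bounded sZ sY (conjugate p) S c"
proof -
  let ?q = "conjugate p"
  interpret seminormed_space tensor_scale "tensor_space sZ sX" "chevet_saphar sZ sX p"
    by (rule seminormed_space_tensor[OF X Z p])
  let ?U = "\<lambda>u. U (completion_embed (tensor_space sZ sX) (chevet_saphar sZ sX p) u)"
  note U' = U[unfolded tensor_operators_def]
  obtain C where C: "0 < C" "\<And>u. u \<in> tensor_space sZ sX \<Longrightarrow> norm (?U u) \<le> C * chevet_saphar sZ sX p u"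
    using completion_operator_embed(2)[OF U'] by blast
  have Ut: "?U (tensor sZ sX z x) = ev z x" for z x
    using assoc by (simp add: associated_def fun_eq_iff)
  have in_space: "tensor sZ sX z x \<in> tensor_space sZ sX" for z x
    using tensor_in_space[where n = 1 and z = "\<lambda>_. z" and x = "\<lambda>_. x" and sZ = sZ and sX = sX] by simp
  have sum: "?U (\<Sum>i<n. tensor sZ sX (z i) (x i)) = (\<Sum>i<n. ev (z i) (x i))" for n :: nat and z x
  proof (induction n)
    case 0
    have "?U 0 = ?U 0 + ?U 0" using completion_operator_embed(1)[OF U' zero_in zero_in] by (simp only: add_0_left)
    then have "?U 0 = 0" by (metis add_cancel_right_right)
    then show ?case by (simp only: lessThan_0 sum.empty)
  next
    case (Suc n)
    show ?case
      unfolding sum.lessThan_Suc completion_operator_embed(1)[OF U' tensor_in_space in_space] Suc Ut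
      by (rule refl)
  qed
  have "weak_norm sY ?q {..<n} (\<lambda>i. ev (z i) (x i)) \<le> ennreal C * strong_norm \<infinity> {..<n} x * weak_norm sZ ?q {..<n} z" for n x z
  proof -
    obtain A where A: "strong_norm \<infinity> {..<n} x = ennreal A" "0 \<le> A"
      using strong_norm_finite[of \<infinity> "{..<n}" x] by (cases "strong_norm \<infinity> {..<n} x") auto
    obtain W where W: "weak_norm sZ ?q {..<n} z = ennreal W" "0 \<le> W"
      using weak_norm_finite[OF q, of "{..<n}" sZ z] by (cases "weak_norm sZ ?q {..<n} z") auto
    have xA: "norm (x i) \<le> A" if "i < n" for i
      using norm_le_strong_norm[of \<infinity> i "{..<n}" x] that A by simp
    have "weak_norm sY ?q {..<n} (\<lambda>i. ev (z i) (x i)) \<le> ennreal (C * (W * A))"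
    proof (rule weak_norm_leI, rule strong_norm_dual_le[OF p])
      fix f and a :: "nat \<Rightarrow> 'k" assume f: "f \<in> dual sY" "norm f \<le> 1" and a: "strong_norm p {..<n} a \<le> 1"
      \<comment> \<open>The coefficients are attached to the x-side, where they are measured in l_p:
        the strong norm is at most \<open>A\<close>, the weak norm of \<open>z\<close> stays
        \<open>W\<close>, and d_p of the tensor is at most W * A.\<close>
      let ?u = "\<Sum>i<n. tensor sZ sX (z i) (sX (a i) (x i))"
      have "(\<Sum>i<n. a i * blinfun_apply f (ev (z i) (x i))) = blinfun_apply f (?U ?u)"
        by (simp add: sum blinfun.sum_right ev_linear dual_apply_scale[OF Y f(1)])
      also have "norm \<dots> \<le> norm (?U ?u)" by (rule norm_dual_apply_le[OF f(2)])
      also have "\<dots> \<le> C * chevet_saphar sZ sX p ?u" by (intro C tensor_in_space)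
      also have "\<dots> \<le> C * (W * A)"
      proof (intro mult_left_mono chevet_saphar_le[OF refl])
        have "strong_norm p {..<n} (\<lambda>i. sX (a i) (x i)) \<le> ennreal A * strong_norm p {..<n} a"
          using xA A by (intro strong_norm_scale_le p) (auto simp: banach_space_norm[OF X] mult.commute[of A] mult_left_mono)
        also have "\<dots> \<le> ennreal A * 1" using a by (intro mult_left_mono) auto
        finally show "strong_norm p {..<n} (\<lambda>i. sX (a i) (x i)) \<le> ennreal A" by simp
      qed (use A W C in auto)
      finally show "norm (\<Sum>i<n. a i * blinfun_apply f (ev (z i) (x i))) \<le> C * (W * A)" .
    qed (use A W C in auto)
    then show ?thesis using A W C by (simp add: ennreal_mult mult_ac)
  qed
  then show ?thesis using C(1) by (auto simp: finitely_bounded_def)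
qed

text \<open>A map is first defined on algebraic tensors, then bounded on one representation at a
  time. Representations that nearly attain d_p turn this into a bound by c * d_p, and continuity
  extends the map to the completion.\<close>

lemma finitely_bounded_imp_tensor_operator:
  assumes c: "0 < c" and b: "finitely_bounded sZ sY (conjugate p) S c"
  shows "\<exists>U\<in>tensor_operators sZ sX sY p. associated sZ sX p U = (\<lambda>z. blinfun_apply (blinfun_apply S z))"
proof -
  let ?q = "conjugate p" and ?E = "tensor_space sZ sX" and ?\<nu> = "chevet_saphar sZ sX p"
  interpret seminormed_space tensor_scale ?E ?\<nu>
    by (rule seminormed_space_tensor[OF X Z p])
  have bilinear: "bilinear_form sZ sX (\<lambda>z x. blinfun_apply f (ev z x))" if f: "f \<in> dual sY" for f
    using banach_space_vector_space[OF X] banach_space_vector_space[OF Z]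
    by (auto simp: bilinear_form_def linear_iff_vector_space vector_space_mult ev_linear
        blinfun.add_left blinfun.add_right dual_apply_scale[OF Y f])
  have eval: "(\<Sum>i<n. tensor sZ sX (z i) (x i)) (\<lambda>z x. blinfun_apply f (ev z x)) = blinfun_apply f (\<Sum>i<n. ev (z i) (x i))"
    if f: "f \<in> dual sY" for f z x and n :: nat
    by (simp add: tensor_sum_apply tensor_def bilinear[OF f] blinfun.sum_right)
  \<comment> \<open>The characterization mentions only \<open>u\<close>, not a representation. The
    value exists because a finite sum of the (S z_i) x_i satisfies it, and is unique because
    functionals separate the points of Y.\<close>
  define L where "L u = (THE y. \<forall>f\<in>dual sY. blinfun_apply f y = u (\<lambda>z x. blinfun_apply f (ev z x)))" for u
  have L_eq: "L u = y" if "\<And>f. f \<in> dual sY \<Longrightarrow> blinfun_apply f y = u (\<lambda>z x. blinfun_apply f (ev z x))" for u y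
    unfolding L_def using that by (intro the_equality) (auto intro: dual_separates[OF Y])
  have L_sum: "L (\<Sum>i<n. tensor sZ sX (z i) (x i)) = (\<Sum>i<n. ev (z i) (x i))" for n :: nat and z x
    by (rule L_eq) (simp add: eval)
  have L_apply: "blinfun_apply f (L u) = u (\<lambda>z x. blinfun_apply f (ev z x))" if "f \<in> dual sY" "u \<in> ?E" for f u
    using that(2) by (auto simp: tensor_space_def L_sum eval[OF that(1)])
  have L_add: "L (u + v) = L u + L v" if "u \<in> ?E" "v \<in> ?E" for u v
    by (rule L_eq) (simp add: blinfun.add_right L_apply that)
  have L_scale: "L (tensor_scale a u) = sY a (L u)" if "u \<in> ?E" for a u
    by (rule L_eq) (simp add: dual_apply_scale[OF Y] L_apply that tensor_scale_def)
  have L_le_rep: "norm (\<Sum>i<n. ev (z i) (x i)) \<le> c * (W * B)"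
    if W: "weak_norm sZ ?q {..<n} z \<le> ennreal W" "0 \<le> W"
      and B: "strong_norm p {..<n} x \<le> ennreal B" "0 \<le> B" for n z x W B
  proof -
    \<comment> \<open>Directions of the vectors. For x i = 0 division by zero gives x' i = 0, so the
      factorization of \<open>x i\<close> and the bound 1 hold there too.\<close>
    define x' where "x' i = (1 / norm (x i)) *\<^sub>R x i" for i
    have x': "x i = norm (x i) *\<^sub>R x' i" "norm (x' i) \<le> 1" for i by (simp_all add: x'_def)
    obtain f where f: "f \<in> dual sY" "norm f \<le> 1"
      "norm (\<Sum>i<n. ev (z i) (x i)) \<le> norm (blinfun_apply f (\<Sum>i<n. ev (z i) (x i)))"
      using exists_norming_dual[OF Y] by blast
    let ?g = "\<lambda>i. blinfun_apply f (ev (z i) (x' i))"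
    have "strong_norm ?q {..<n} ?g \<le> weak_norm sY ?q {..<n} (\<lambda>i. ev (z i) (x' i))"
      by (rule strong_norm_le_weak_norm[OF f(1,2)])
    also have "\<dots> \<le> ennreal c * strong_norm \<infinity> {..<n} x' * weak_norm sZ ?q {..<n} z"
      using b by (simp add: finitely_bounded_def)
    also have "\<dots> \<le> ennreal c * ennreal 1 * ennreal W"
    proof (intro mult_mono order_refl W(1))
      show "strong_norm \<infinity> {..<n} x' \<le> ennreal 1"
        using strong_norm_infinity_le_iff[of 1 "{..<n}" x'] x'(2) by simp
    qed auto
    also have "\<dots> = ennreal (c * W)" using c W by (simp add: ennreal_mult)
    finally have g: "strong_norm ?q {..<n} ?g \<le> ennreal (c * W)" .
    have "norm (\<Sum>i<n. ev (z i) (x i)) \<le> norm (\<Sum>i<n. norm (x i) *\<^sub>R ?g i)"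
      using f(3) by (subst (asm) (2) x'(1)) (simp add: blinfun.sum_right blinfun.scaleR_right)
    also have "\<dots> \<le> (\<Sum>i<n. norm (x i) * norm (?g i))"
      by (rule order_trans[OF norm_sum]) simp
    also have "\<dots> \<le> B * (c * W)" using g B W c by (intro holder_sum[OF p]) auto
    finally show ?thesis by (simp add: mult_ac)
  qed
  have L_le: "norm (L u) \<le> c * ?\<nu> u" if u: "u \<in> ?E" for u
  proof (rule field_le_epsilon)
    fix e :: real assume e: "0 < e"
    \<comment> \<open>The infimum need not be attained; the margin e / c becomes \<open>e\<close>
      after multiplication by \<open>c\<close>.\<close>
    define d where "d = ?\<nu> u + e / c"
    have d: "?\<nu> u < d" "0 < d" using e c norm_nonneg[of u] by (auto simp: d_def add_nonneg_pos)
    obtain n z x where "u = (\<Sum>i<n. tensor sZ sX (z i) (x i))"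
      "weak_norm sZ ?q {..<n} z \<le> ennreal (d powr enn2real (inverse ?q))"
      "strong_norm p {..<n} x \<le> ennreal (d powr enn2real (inverse p))"
      by (rule chevet_saphar_balanced[OF X Z p u d(1)])
    then have "norm (L u) \<le> c * (d powr enn2real (inverse ?q) * d powr enn2real (inverse p))"
      by (auto simp: L_sum intro: L_le_rep)
    also have "\<dots> = c * ?\<nu> u + e"
      using d(2) c by (simp flip: powr_add add: inverse_conjugate_sum[OF p]) (simp add: d_def distrib_left)
    finally show "norm (L u) \<le> c * ?\<nu> u + e" .
  qed
  obtain U where U: "U \<in> completion_operators tensor_scale ?E ?\<nu> sY"
    and UL: "\<And>u. u \<in> ?E \<Longrightarrow> U (completion_embed ?E ?\<nu> u) = L u"
    using completion_operator_extend[OF Y L_add L_scale L_le c] by blast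
  have "associated sZ sX p U z x = ev z x" for z x
    using UL[OF tensor_in_space[where n = 1 and z = "\<lambda>_. z" and x = "\<lambda>_. x" and sZ = sZ and sX = sX]] L_sum[where n = 1 and z = "\<lambda>_. z" and x = "\<lambda>_. x"]
    by (simp add: associated_def)
  then have "associated sZ sX p U = (\<lambda>z. blinfun_apply (blinfun_apply S z))" by (intro ext)
  then show ?thesis using U unfolding tensor_operators_def by blast
qed

end

theorem theorem3p3:
  fixes sX :: "'k::real_or_complex \<Rightarrow> 'x::banach \<Rightarrow> 'x"
    and sY :: "'k \<Rightarrow> 'y::banach \<Rightarrow> 'y"
    and sZ :: "'k \<Rightarrow> 'z::banach \<Rightarrow> 'z"
    and p :: ennreal
    and S :: "'z \<Rightarrow>\<^sub>L ('x \<Rightarrow>\<^sub>L 'y)"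
  assumes "banach_space sX" and "banach_space sY" and "banach_space sZ"
    and "1 \<le> p"
    and "S \<in> operators2 sZ sX sY"
  shows
    "let p' = conjugate p;
         Sx = (\<lambda>z x i. blinfun_apply (blinfun_apply S (z i)) (x i)) :: (nat \<Rightarrow> 'z) \<Rightarrow> (nat \<Rightarrow> 'x) \<Rightarrow> nat \<Rightarrow> 'y;
         a = (\<exists>U\<in>tensor_operators sZ sX sY p.
                associated sZ sX p U = (\<lambda>z. blinfun_apply (blinfun_apply S z)));
         b = (\<exists>c::real. c > 0 \<and>
                (\<forall>n x z. weak_norm sY p' {..<n} (Sx z x)
                   \<le> ennreal c * strong_norm \<infinity> {..<n} x * weak_norm sZ p' {..<n} z));
         b' = (\<exists>c::real. c > 0 \<and>
                (\<forall>x z. bounded (range x) \<and> z \<in> weakly_summable sZ p' \<longrightarrow>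
                   (\<forall>n. weak_norm sY p' {n..} (Sx z x)
                      \<le> ennreal c * strong_norm \<infinity> {n..} x * weak_norm sZ p' {n..} z)));
         c = (\<forall>x z. bounded (range x) \<and> z \<in> weakly_summable sZ p' \<longrightarrow>
                Sx z x \<in> weakly_summable sY p');
         d = (\<forall>x z. x \<longlonglongrightarrow> 0 \<and> z \<in> weakly_summable sZ p' \<longrightarrow>
                Sx z x \<in> unconditionally_summable sY p');
         d' = (\<forall>x z. bounded (range x) \<and> z \<in> unconditionally_summable sZ p' \<longrightarrow>
                Sx z x \<in> unconditionally_summable sY p')
     in (a \<longleftrightarrow> b) \<and> (b \<longleftrightarrow> b') \<and> (b' \<longleftrightarrow> c) \<and> (c \<longleftrightarrow> d) \<and> (d \<longleftrightarrow> d')"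
proof -
  note X = assms(1) and Y = assms(2) and Z = assms(3) and p = assms(4) and S = assms(5)
  let ?q = "conjugate p"
  define Sx :: "(nat \<Rightarrow> 'z) \<Rightarrow> (nat \<Rightarrow> 'x) \<Rightarrow> nat \<Rightarrow> 'y"
    where "Sx = (\<lambda>z x i. blinfun_apply (blinfun_apply S (z i)) (x i))"
  define a where "a \<longleftrightarrow> (\<exists>U\<in>tensor_operators sZ sX sY p. associated sZ sX p U = (\<lambda>z. blinfun_apply (blinfun_apply S z)))"
  define b where "b \<longleftrightarrow> (\<exists>c>0. finitely_bounded sZ sY ?q S c)"
  define b' where "b' \<longleftrightarrow> (\<exists>c>0. tail_bounded sZ sY ?q S c)"
  define c where "c \<longleftrightarrow> (\<forall>x z. bounded (range x) \<and> z \<in> weakly_summable sZ ?q \<longrightarrow> Sx z x \<in> weakly_summable sY ?q)"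
  define d where "d \<longleftrightarrow> (\<forall>x z. x \<longlonglongrightarrow> 0 \<and> z \<in> weakly_summable sZ ?q \<longrightarrow> Sx z x \<in> unconditionally_summable sY ?q)"
  define d' where "d' \<longleftrightarrow> (\<forall>x z. bounded (range x) \<and> z \<in> unconditionally_summable sZ ?q \<longrightarrow> Sx z x \<in> unconditionally_summable sY ?q)"
  note est = tail_bounded_estimates[OF X Y Z p S]
  have ab: "a \<longleftrightarrow> b"
    unfolding a_def b_def
    using tensor_operator_imp_finitely_bounded[OF X Y Z p S] finitely_bounded_imp_tensor_operator[OF X Y Z p S] by blast
  have bb': "b \<Longrightarrow> b'"
    unfolding b_def b'_def using finitely_bounded_imp_tail_bounded[OF X Y Z p S] by blast
  have b'c: "b' \<Longrightarrow> c"
    unfolding b'_def c_def Sx_def using est(1) weakly_summable_iff[OF Y p] by blast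
  have b'd: "b' \<Longrightarrow> d"
    unfolding d_def
  proof (intro allI impI)
    fix x :: "nat \<Rightarrow> 'x" and z :: "nat \<Rightarrow> 'z" assume b' and x: "x \<longlonglongrightarrow> 0 \<and> z \<in> weakly_summable sZ ?q"
    then obtain k where k: "tail_bounded sZ sY ?q S k" by (auto simp: b'_def)
    have bx: "bounded (range x)" using x by (auto intro: convergent_imp_bounded)
    obtain C where C: "C < top" "\<And>N. weak_norm sY ?q {N..} (Sx z x) \<le> C * strong_norm \<infinity> {N..} x"
      using est(2)[OF k bx] x unfolding Sx_def by blast
    from x have "(\<lambda>N. strong_norm \<infinity> {N..} x) \<longlonglongrightarrow> 0"
      by (intro strong_norm_infinity_tail_tendsto) simp
    from ennreal_tendsto_zero_dominated[OF this C]
    have "(\<lambda>N. weak_norm sY ?q {N..} (Sx z x)) \<longlonglongrightarrow> 0" .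
    then show "Sx z x \<in> unconditionally_summable sY ?q"
      using est(1)[OF k bx] x unconditionally_summable_iff[OF Y p, of "Sx z x"] by (simp add: Sx_def)
  qed
  have b'd': "b' \<Longrightarrow> d'"
    unfolding d'_def
  proof (intro allI impI)
    fix x :: "nat \<Rightarrow> 'x" and z :: "nat \<Rightarrow> 'z" assume b' and xz: "bounded (range x) \<and> z \<in> unconditionally_summable sZ ?q"
    then obtain k where k: "tail_bounded sZ sY ?q S k" by (auto simp: b'_def)
    have z: "z \<in> weakly_summable sZ ?q" using xz by (simp add: unconditionally_summable_def)
    obtain C where C: "C < top" "\<And>N. weak_norm sY ?q {N..} (Sx z x) \<le> C * weak_norm sZ ?q {N..} z"
      using est(3)[OF k _ z] xz unfolding Sx_def by blast
    have "(\<lambda>N. weak_norm sZ ?q {N..} z) \<longlonglongrightarrow> 0"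
      using xz unconditionally_summable_iff[OF Z p] by blast
    from ennreal_tendsto_zero_dominated[OF this C]
    have "(\<lambda>N. weak_norm sY ?q {N..} (Sx z x)) \<longlonglongrightarrow> 0" .
    then show "Sx z x \<in> unconditionally_summable sY ?q"
      using est(1)[OF k _ z] xz unconditionally_summable_iff[OF Y p, of "Sx z x"] by (simp add: Sx_def)
  qed
  have "\<not> c \<and> \<not> d \<and> \<not> d'" if "\<not> b"
  proof -
    have nb: "\<not> finitely_bounded sZ sY ?q S k" if "0 < k" for k using \<open>\<not> b\<close> that by (auto simp: b_def)
    obtain x z where xz: "x \<longlonglongrightarrow> 0" "z \<in> unconditionally_summable sZ ?q" "Sx z x \<notin> weakly_summable sY ?q"
      using not_finitely_bounded_sequences[OF X Y Z p S nb] unfolding Sx_def by blast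
    moreover have "bounded (range x)" using xz(1) by (auto intro: convergent_imp_bounded)
    moreover have "z \<in> weakly_summable sZ ?q" "Sx z x \<notin> unconditionally_summable sY ?q"
      using xz by (auto simp: unconditionally_summable_def)
    ultimately show ?thesis unfolding c_def d_def d'_def by blast
  qed
  \<comment> \<open>\<open>b\<close> gives \<open>b'\<close>, which gives \<open>c\<close>,
    \<open>d\<close> and \<open>d'\<close>, and each of these three gives back \<open>b\<close>. The
    way from \<open>b'\<close> to \<open>b\<close> thus leads through the sequences.\<close>
  then have "(a \<longleftrightarrow> b) \<and> (b \<longleftrightarrow> b') \<and> (b' \<longleftrightarrow> c) \<and> (c \<longleftrightarrow> d) \<and> (d \<longleftrightarrow> d')"
    using ab bb' b'c b'd b'd' by blast
  then show ?thesis
    unfolding Let_def a_def b_def b'_def c_def d_def d'_def Sx_def finitely_bounded_def tail_bounded_def .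
qed

end
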